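(* Let $x^\star$ be an optimal solution of $F^\star=\min_{x\in\mathbb{R}^p}\{F(x)=f(x)+g(x)+h(Ax)\}$, where $f,g,h,A$ are as in the context and $h:\mathbb{R}^m\to\mathbb{R}$ is Lipschitz continuous (equivalently, $\mathrm{dom}(h^* )$ is bounded), and let $\beta_1>0$ be given. In addition, let $\tau_0:=\min\{q_i\mid i\in[n]\}\in(0,1]$ and $\beta_0:=(1+\tau_0)\beta_1$. Then, for all $k\ge 1$, the sequence $\{\bar x^k\}$ generated by the SMART-CD algorithm described in the context satisfies $$\mathbb{E}\left[F(\bar x^k)-F^\star\right]\le \frac{C^*(x^0)}{\tau_0(k-1)+1}+\frac{\beta_1(1+\tau_0)D_{h^*}^2}{2(\tau_0k+1)},$$ where $$C^*(x^0):=(1-\tau_0)\left(F_{\beta_0}(x^0)-F^\star\right)+\sum_{i=1}^n\frac{\tau_0B_i^0}{2q_i}\|x_i^\star-x_i^0\|_{(i)}^2,\qquad D_{h^*}:=\sup_{y\in\mathrm{dom}(h^* )}\|y-\dot y\|<+\infty .$$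
   Context: **Notation.** $[n]=\{1,\dots,n\}$. Vectors $x\in\mathbb{R}^p$ are split into $n$ blocks $x=[x_1;\dots;x_n]$ with $x_i\in\mathbb{R}^{p_i}$, $p_i\ge1$, $\sum_i p_i=p$; the identity is split as $\mathbb{I}_p=[U_1,\dots,U_n]$ with $U_i\in\mathbb{R}^{p\times p_i}$, so $x_i=U_i^\top x$; $\nabla_if(x)=U_i^\top\nabla f(x)$. For $A\in\mathbb{R}^{m\times p}$, $A_i=AU_i\in\mathbb{R}^{m\times p_i}$ is its $i$-th column block. $\|\cdot\|$ is the Euclidean norm. For each $i$, $H_i\in\mathbb{R}^{p_i\times p_i}$ is a given symmetric positive definite matrix, $\|x_i\|_{(i)}^2=\langle H_ix_i,x_i\rangle$ and $(\|y_i\|_{(i)}^* )^2=\langle H_i^{-1}y_i,y_i\rangle$. $\|A_i\|$ is the operator norm of $A_i$ from $(\mathbb{R}^{p_i},\|\cdot\|_{(i)})$ to $(\mathbb{R}^m,\|\cdot\|)$. $h^*$ is the Fenchel conjugate of $h$. **Assumptions on the problem.** $f:\mathbb{R}^p\to\mathbb{R}$, $g:\mathbb{R}^p\to\mathbb{R}\cup\{+\infty\}$ and $h$ are proper, closed and convex. $f$ is differentiable and for each $i$ there is $\hat L_i\in[0,\infty)$ with $\|\nabla_if(x+U_id_i)-\nabla_if(x)\|_{(i)}^*\le\hat L_i\|d_i\|_{(i)}$ for all $x\in\mathbb{R}^p$, $d_i\in\mathbb{R}^{p_i}$. $g$ is separable: $g(x)=\sum_{i=1}^ng_i(x_i)$.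 **Smoothing.** Fix $\dot y\in\mathbb{R}^m$. For $\beta>0$, $h_\beta(u):=\max_{y\in\mathbb{R}^m}\{\langle u,y\rangle-h^*(y)-\frac{\beta}{2}\|y-\dot y\|^2\}$, with unique maximizer denoted $y_\beta^*(u)$. Put $F_\beta(x):=f(x)+g(x)+h_\beta(Ax)$ (values in $\mathbb{R}\cup\{+\infty\}$, with $0\cdot(+\infty)=0$). **SMART-CD algorithm.** Inputs: $\beta_1>0$, $\alpha\in[0,1]$, $x^0\in\mathbb{R}^p$. Set $B_i^0:=\hat L_i+\|A_i\|^2/\beta_1$ (assumed $>0$) for $i\in[n]$, $S_\alpha:=\sum_{i=1}^n(B_i^0)^\alpha$, $q_i:=(B_i^0)^\alpha/S_\alpha$, $\tau_0:=\min_iq_i$, $\bar x^0=\tilde x^0:=x^0$. For $k=0,1,2,\dots$: 1. $\hat x^k:=(1-\tau_k)\bar x^k+\tau_k\tilde x^k$. 2. $y_k^*:=y_{\beta_{k+1}}^*(A\hat x^k)$. 3. Draw $i_k\in[n]$ with $\mathbb{P}\{i_k=i\}=q_i$, independently of the previous draws. 4. Set $\tilde x^{k+1}:=\tilde x^k$ except for block $i_k$, where $\tilde x_{i_k}^{k+1}:=\arg\min_{x_{i_k}\in\mathbb{R}^{p_{i_k}}}\{\langle\nabla_{i_k}f(\hat x^k)+A_{i_k}^\top y_k^*,x_{i_k}-\hat x_{i_k}^k\rangle+g_{i_k}(x_{i_k})+\frac{\tau_kB_{i_k}^k}{2\tau_0}\|x_{i_k}-\tilde x_{i_k}^k\|_{(i_k)}^2\}$.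 5. $\bar x^{k+1}:=\hat x^k+\frac{\tau_k}{\tau_0}(\tilde x^{k+1}-\tilde x^k)$. 6. $\tau_{k+1}\in(0,1)$ is the unique positive root of $\tau^3+\tau^2+\tau_k^2\tau-\tau_k^2=0$. 7. $\beta_{k+2}:=\beta_{k+1}/(1+\tau_{k+1})$ and $B_i^{k+1}:=\hat L_i+\|A_i\|^2/\beta_{k+2}$ for $i\in[n]$. $\mathbb{E}$ is expectation over the random indices $i_0,i_1,\dots$. *)

theory Defs
  imports "HOL-Probability.Probability"
begin

text \<open>
  A splitting of \<open>R^p\<close> into blocks is given by a surjection \<open>blk :: 'p \<Rightarrow> 'n\<close> that sends a
  coordinate to its block.  The block dimensions differ, so \<open>R^{p_i}\<close> is rendered as the
  coordinate subspace \<^term>\<open>block_space blk i\<close> of \<^typ>\<open>real^'p\<close>: a block vector \<open>d\<close> is identified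
  with \<open>U_i d\<close>, and \<open>x_i = U_i^T x\<close> with \<^term>\<open>block_part blk i x\<close>.
\<close>

definition block_space :: "('p::finite \<Rightarrow> 'n) \<Rightarrow> 'n \<Rightarrow> (real^'p) set" where
  "block_space blk i = {x. \<forall>j. blk j \<noteq> i \<longrightarrow> x $ j = 0}"

definition block_part :: "('p::finite \<Rightarrow> 'n) \<Rightarrow> 'n \<Rightarrow> real^'p \<Rightarrow> real^'p" where
  "block_part blk i x = (\<chi> j. if blk j = i then x $ j else 0)"

text \<open>A \<open>p_i \<times> p_i\<close> matrix is padded with zeros to a \<open>p \<times> p\<close> one.\<close>

definition block_spd :: "('p::finite \<Rightarrow> 'n) \<Rightarrow> 'n \<Rightarrow> real^'p^'p \<Rightarrow> bool" where
  "block_spd blk i H \<longleftrightarrow>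
     (\<forall>j l. blk j \<noteq> i \<or> blk l \<noteq> i \<longrightarrow> H $ j $ l = 0) \<and>
     transpose H = H \<and>
     (\<forall>x\<in>block_space blk i. x \<noteq> 0 \<longrightarrow> (H *v x) \<bullet> x > 0)"

definition block_norm :: "real^'p^'p \<Rightarrow> real^'p \<Rightarrow> real" where
  "block_norm H x = sqrt ((H *v x) \<bullet> x)"

text \<open>The padded matrix is singular on \<open>R^p\<close>; its inverse is that of its restriction to
  the block space.\<close>

definition block_dual_norm :: "('p::finite \<Rightarrow> 'n) \<Rightarrow> 'n \<Rightarrow> real^'p^'p \<Rightarrow> real^'p \<Rightarrow> real" where
  "block_dual_norm blk i H y = sqrt (inv_into (block_space blk i) ((*v) H) y \<bullet> y)"

text \<open>Since \<open>A_i d_i = A (U_i d_i)\<close>, this is the operator norm of the column block \<open>A_i\<close>.\<close>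

definition block_opnorm ::
  "('p::finite \<Rightarrow> 'n) \<Rightarrow> 'n \<Rightarrow> real^'p^'p \<Rightarrow> real^'p^'m::finite \<Rightarrow> real" where
  "block_opnorm blk i H A = (SUP d\<in>{d\<in>block_space blk i. block_norm H d \<le> 1}. norm (A *v d))"

definition gradient :: "('a::real_inner \<Rightarrow> real) \<Rightarrow> 'a \<Rightarrow> 'a" where
  "gradient f x = (THE D. GDERIV f x :> D)"

text \<open>Closedness and convexity are those of the epigraph.\<close>

definition proper_closed_convex :: "('a::euclidean_space \<Rightarrow> ereal) \<Rightarrow> bool" where
  "proper_closed_convex \<phi> \<longleftrightarrow>
     (\<forall>x. \<phi> x \<noteq> -\<infinity>) \<and> (\<exists>x. \<phi> x \<noteq> \<infinity>) \<and>
     closed {(x, r). \<phi> x \<le> ereal r} \<and> convex {(x, r). \<phi> x \<le> ereal r}"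

definition fenchel_conj :: "('a::real_inner \<Rightarrow> ereal) \<Rightarrow> 'a \<Rightarrow> ereal" where
  "fenchel_conj \<phi> y = (SUP u. ereal (u \<bullet> y) - \<phi> u)"

definition effective_dom :: "('a \<Rightarrow> ereal) \<Rightarrow> 'a set" where
  "effective_dom \<phi> = {x. \<phi> x < \<infinity>}"

definition smoothing_obj ::
  "('a::real_inner \<Rightarrow> real) \<Rightarrow> 'a \<Rightarrow> real \<Rightarrow> 'a \<Rightarrow> 'a \<Rightarrow> ereal" where
  "smoothing_obj h ydot \<beta> u y =
     ereal (u \<bullet> y) - fenchel_conj (\<lambda>v. ereal (h v)) y - ereal (\<beta> / 2 * (norm (y - ydot))\<^sup>2)"

definition smoothed :: "('a::real_inner \<Rightarrow> real) \<Rightarrow> 'a \<Rightarrow> real \<Rightarrow> 'a \<Rightarrow> ereal" where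
  "smoothed h ydot \<beta> u = (SUP y. smoothing_obj h ydot \<beta> u y)"

definition obj_F ::
  "(real^'p \<Rightarrow> real) \<Rightarrow> (real^'p \<Rightarrow> ereal) \<Rightarrow> (real^'m::finite \<Rightarrow> real) \<Rightarrow> real^'p^'m \<Rightarrow>
   real^'p \<Rightarrow> ereal" where
  "obj_F f g h A x = ereal (f x) + g x + ereal (h (A *v x))"

definition obj_F_smoothed ::
  "(real^'p \<Rightarrow> real) \<Rightarrow> (real^'p \<Rightarrow> ereal) \<Rightarrow> (real^'m::finite \<Rightarrow> real) \<Rightarrow> real^'p^'m \<Rightarrow>
   real^'m \<Rightarrow> real \<Rightarrow> real^'p \<Rightarrow> ereal" where
  "obj_F_smoothed f g h A ydot \<beta> x = ereal (f x) + g x + smoothed h ydot \<beta> (A *v x)"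

definition dual_radius :: "('a::real_inner \<Rightarrow> real) \<Rightarrow> 'a \<Rightarrow> ereal" where
  "dual_radius h ydot =
     (SUP y\<in>effective_dom (fenchel_conj (\<lambda>v. ereal (h v))). ereal (norm (y - ydot)))"

text \<open>The objective of the proximal subproblem for block \<open>i\<close>, with \<open>c\<close> the coefficient of the
  squared norm.  It is meant for \<open>z\<close> in \<^term>\<open>block_space blk i\<close>;
  \<^term>\<open>block_part blk i (transpose A *v y)\<close> is \<open>A_i^T y\<close>.\<close>

definition block_model ::
  "('p::finite \<Rightarrow> 'n) \<Rightarrow> ('n \<Rightarrow> real^'p^'p) \<Rightarrow> (real^'p \<Rightarrow> real) \<Rightarrow> ('n \<Rightarrow> real^'p \<Rightarrow> ereal) \<Rightarrow>
   real^'p^'m::finite \<Rightarrow> 'n \<Rightarrow> real \<Rightarrow> real^'p \<Rightarrow> real^'p \<Rightarrow> real^'m \<Rightarrow> real^'p \<Rightarrow> ereal" where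
  "block_model blk H f gb A i c xhat xtil y z =
     ereal ((block_part blk i (gradient f xhat) + block_part blk i (transpose A *v y))
              \<bullet> (z - block_part blk i xhat))
     + gb i z
     + ereal (c / 2 * (block_norm (H i) (z - block_part blk i xtil))\<^sup>2)"

text \<open>For nonnegative extended-real random variables (possibly infinite).\<close>

definition ereal_expectation :: "'w measure \<Rightarrow> ('w \<Rightarrow> ereal) \<Rightarrow> ereal" where
  "ereal_expectation M X = enn2ereal (\<integral>\<^sup>+ \<omega>. e2ennreal (X \<omega>) \<partial>M)"

end

theory Submission
  imports Defs
begin

text \<open>
  The proof is a Lyapunov argument in expectation.  A step of the method is a proximal coordinate
  step on the smoothed objective.  Its smooth part \<open>f + h\<^sub>\<beta> \<circ> A\<close> has a quadratic upper bound in each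
  block, with constant \<open>L\<^sub>i + \<parallel>A\<^sub>i\<parallel>\<^sup>2 / \<beta>\<close> (\<open>smoothed_block_descent\<close>), and the prox subproblem is
  strongly convex (\<open>argmin_growth\<close>).  Averaging the two over the drawn block gives (\<open>one_step\<close>)
  that the expected value of gap plus weighted squared distance to \<open>x\<^sup>\<star>\<close> after step \<open>k\<close> is at
  most \<open>(1 - \<tau>\<^sub>k)\<close> times the gap plus the weighted distance before it.

  Three observations turn this into a recursion.
  \<^item> The update of the averaged iterate has a negative coefficient, so that convexity does not bound
    \<open>g (xbar)\<close> along a single step.  The gap is therefore measured with the value \<open>Gh\<close> that results
    when the linear recursion for the averaged iterate is applied to the numbers \<open>g (xtil)\<close>.  It
    dominates \<open>g (xbar)\<close>, since the averaged iterate is a convex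
    combination of prox iterates (\<open>averaged_iterate_in_epigraph\<close>).
  \<^item> Passing from \<open>\<beta>\<^sub>k = (1 + \<tau>\<^sub>k) \<beta>\<^sub>k\<^sub>+\<^sub>1\<close> to \<open>\<beta>\<^sub>k\<^sub>+\<^sub>1\<close> costs
    \<open>(1 - \<tau>\<^sub>k) \<tau>\<^sub>k \<beta>\<^sub>k\<^sub>+\<^sub>1 / 2\<close> times the squared distance of the dual maximizer from the centre, and
    comparing \<open>h\<^sub>\<beta>\<close> with \<open>h\<close> at \<open>x\<^sup>\<star>\<close> gains \<open>\<tau>\<^sub>k \<beta>\<^sub>k\<^sub>+\<^sub>1 / 2\<close> times the same quantity.
  \<^item> The cubic equation for the step size says that \<open>\<tau>\<^sub>k\<^sup>2\<close> decreases by the factor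
    \<open>(1 - \<tau>\<^sub>k\<^sub>+\<^sub>1) / (1 + \<tau>\<^sub>k\<^sub>+\<^sub>1)\<close>, while the block constants grow at most by \<open>1 + \<tau>\<^sub>k\<^sub>+\<^sub>1\<close>.  So
    the distance weights contract by \<open>1 - \<tau>\<^sub>k\<^sub>+\<^sub>1\<close>, just as the gap does (\<open>wdist_Suc_le\<close>).

  With \<open>h \<le> h\<^sub>\<beta> + \<beta> D\<^sup>2 / 2\<close>, where \<open>D\<close> is the dual radius, the expected gap after \<open>n + 1\<close> steps is
  bounded by \<open>\<Prod>\<^sub>l (1 - \<tau>\<^sub>l) C\<^sup>* + \<beta>\<^sub>n\<^sub>+\<^sub>1 D\<^sup>2 / 2\<close>, the product running over \<open>1 \<le> l \<le> n\<close>, and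
  \<open>\<tau>\<^sub>l \<ge> \<tau>\<^sub>0 / (\<tau>\<^sub>0 l + 1)\<close> turns the two terms into those of the theorem, provided that \<open>C\<^sup>* \<ge> 0\<close>.

  The constant \<open>C\<^sup>*\<close> can be negative, because the smoothed objective lies below the original one.
  Then replacing the product by the larger number \<open>1 / (\<tau>\<^sub>0 n + 1)\<close> decreases the bound.  What
  rescues the rate is a term that the first step leaves over:
  \<open>\<tau>\<^sub>0\<^sup>2 \<beta>\<^sub>1 / 2\<close> times the squared distance of the first dual maximizer from the centre.  A very negative
  \<open>C\<^sup>*\<close> means that smoothing lowers \<open>h\<close> at \<open>A x\<^sup>0\<close> almost as much as the dual radius permits, and this
  forces that distance to be comparable to the radius (\<open>h_le_sm_argmax\<close>).
  Lemma \<open>negative_gap_rate\<close> weighs the two effects against each other; a mildly negative \<open>C\<^sup>*\<close> is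
  paid for by the amount by which \<open>\<beta>\<^sub>n\<^sub>+\<^sub>1\<close> is below its bound.

  The expectations are finite sums: the iterates depend only on the indices drawn so far, since
  both optimization problems of a step have unique solutions, and every finite history has
  positive probability.
\<close>

section \<open>Blocks and their norms\<close>

lemma block_space_subspace: "subspace (block_space blk i)"
  by (auto simp: subspace_def block_space_def)

lemma block_space_closed [simp, intro]:
  assumes "x \<in> block_space blk i"
  shows "c *\<^sub>R x \<in> block_space blk i"
    and "y \<in> block_space blk i \<Longrightarrow> x + y \<in> block_space blk i"
    and "y \<in> block_space blk i \<Longrightarrow> x - y \<in> block_space blk i"
  using assms by (auto simp: block_space_def)

lemma block_part_in_space [simp]: "block_part blk i x \<in> block_space blk i"
  by (auto simp: block_part_def block_space_def)

lemma block_part_of_space: "z \<in> block_space blk i \<Longrightarrow> block_part blk i z = z"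
  by (auto simp: block_part_def block_space_def vec_eq_iff)

lemma block_part_of_other_space: "z \<in> block_space blk i \<Longrightarrow> j \<noteq> i \<Longrightarrow> block_part blk j z = 0"
  by (auto simp: block_part_def block_space_def vec_eq_iff)

lemma block_part_linear: "linear (block_part blk i)"
  by (rule linearI) (auto simp: block_part_def vec_eq_iff)

lemmas block_part_add = linear_add[OF block_part_linear]
  and block_part_diff = linear_diff[OF block_part_linear]
  and block_part_scale = linear_cmul[OF block_part_linear]

lemma sum_block_part:
  fixes blk :: "'p::finite \<Rightarrow> 'n::finite"
  shows "(\<Sum>i\<in>UNIV. block_part blk i x) = x"
  by (auto simp: block_part_def vec_eq_iff)

lemma block_part_ext:
  fixes blk :: "'p::finite \<Rightarrow> 'n::finite"
  assumes "\<And>i. block_part blk i x = block_part blk i y"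
  shows "x = y"
proof -
  have "x = (\<Sum>i\<in>UNIV. block_part blk i x)"
    by (rule sum_block_part[symmetric])
  also have "\<dots> = (\<Sum>i\<in>UNIV. block_part blk i y)"
    by (intro sum.cong refl assms)
  also have "\<dots> = y"
    by (rule sum_block_part)
  finally show ?thesis .
qed

lemma inner_block_part: "z \<in> block_space blk i \<Longrightarrow> block_part blk i x \<bullet> z = x \<bullet> z"
  by (auto simp: block_part_def block_space_def inner_vec_def intro!: sum.cong)

lemma inner_eq_sum_blocks:
  fixes blk :: "'p::finite \<Rightarrow> 'n::finite"
  shows "x \<bullet> y = (\<Sum>i\<in>UNIV. x \<bullet> block_part blk i y)"
  unfolding inner_sum_right[symmetric] sum_block_part ..

lemma block_part_update:
  assumes "z \<in> block_space blk i"
  shows "block_part blk j (x + c *\<^sub>R (z - block_part blk i x))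
    = (if j = i then (1 - c) *\<^sub>R block_part blk i x + c *\<^sub>R z else block_part blk j x)"
  using assms block_part_of_other_space[OF block_part_in_space, of j i]
  by (auto simp: block_part_add block_part_diff block_part_scale block_part_of_space
      block_part_of_other_space algebra_simps)

locale spd_block =
  fixes blk :: "'p::finite \<Rightarrow> 'n" and i :: 'n and H :: "real^'p^'p"
  assumes spd: "block_spd blk i H"
begin

abbreviation "E \<equiv> block_space blk i"

lemma H_sym: "(H *v x) \<bullet> y = (H *v y) \<bullet> x"
  using spd unfolding block_spd_def by (metis dot_lmul_matrix inner_commute transpose_matrix_vector)

lemma H_pos: "x \<in> E \<Longrightarrow> x \<noteq> 0 \<Longrightarrow> 0 < (H *v x) \<bullet> x"
  using spd unfolding block_spd_def by auto

lemma H_nonneg: "x \<in> E \<Longrightarrow> 0 \<le> (H *v x) \<bullet> x"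
  using H_pos[of x] by (cases "x = 0") auto

lemma H_maps: "H *v x \<in> E"
  using spd unfolding block_spd_def block_space_def matrix_vector_mult_def by auto

lemma block_norm_nonneg [simp]: "x \<in> E \<Longrightarrow> 0 \<le> block_norm H x"
  using H_nonneg by (simp add: block_norm_def)

lemma block_norm_sq: "x \<in> E \<Longrightarrow> (block_norm H x)\<^sup>2 = (H *v x) \<bullet> x"
  using H_nonneg by (simp add: block_norm_def)

lemma block_norm_pos: "x \<in> E \<Longrightarrow> x \<noteq> 0 \<Longrightarrow> 0 < block_norm H x"
  using H_pos by (simp add: block_norm_def)

lemma block_norm_scale: "x \<in> E \<Longrightarrow> block_norm H (c *\<^sub>R x) = \<bar>c\<bar> * block_norm H x"
  by (simp add: block_norm_def matrix_vector_mult_scaleR real_sqrt_mult flip: power2_eq_square mult.assoc)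

lemma block_norm_sq_convex_comb:
  assumes "x \<in> E" "y \<in> E"
  shows "(block_norm H ((1 - s) *\<^sub>R x + s *\<^sub>R y))\<^sup>2
    = (1 - s) * (block_norm H x)\<^sup>2 + s * (block_norm H y)\<^sup>2 - s * (1 - s) * (block_norm H (y - x))\<^sup>2"
proof -
  have "(1 - s) *\<^sub>R x + s *\<^sub>R y \<in> E" "y - x \<in> E"
    using assms by auto
  then show ?thesis
    using assms H_sym[of x y]
    by (simp add: block_norm_sq matrix_vector_right_distrib matrix_vector_mult_scaleR
        matrix_vector_mult_diff_distrib inner_add_left inner_add_right inner_diff_left inner_diff_right)
       (simp add: algebra_simps)
qed

lemma H_Cauchy_Schwarz:
  assumes x: "x \<in> E" and y: "y \<in> E"
  shows "(H *v x) \<bullet> y \<le> block_norm H x * block_norm H y"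
proof (cases "x = 0 \<or> y = 0")
  case True
  then show ?thesis by (auto simp: block_norm_def)
next
  case False
  let ?a = "block_norm H y" and ?b = "block_norm H x"
  have ab: "0 < ?a" "0 < ?b"
    using False x y block_norm_pos by auto
  have "?a *\<^sub>R x - ?b *\<^sub>R y \<in> E"
    using x y by auto
  from H_nonneg[OF this]
  have "0 \<le> ?a\<^sup>2 * ((H *v x) \<bullet> x) + ?b\<^sup>2 * ((H *v y) \<bullet> y) - 2 * ?a * ?b * ((H *v x) \<bullet> y)"
    using H_sym[of x y]
    by (simp add: matrix_vector_mult_diff_distrib matrix_vector_mult_scaleR inner_diff_left
        inner_diff_right power2_eq_square algebra_simps)
  then have "0 \<le> 2 * ?a * ?b * (?a * ?b - (H *v x) \<bullet> y)"
    unfolding block_norm_sq[OF x, symmetric] block_norm_sq[OF y, symmetric]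
    by (simp add: power2_eq_square algebra_simps)
  then have "0 \<le> ?a * ?b - (H *v x) \<bullet> y"
    using mult_pos_pos[OF ab] zero_le_mult_iff[of "2 * ?a * ?b" "?a * ?b - (H *v x) \<bullet> y"] by linarith
  then show ?thesis by (simp add: mult.commute)
qed

text \<open>This makes the inverse of the padded matrix, as it occurs in the dual norm, a genuine one.\<close>

lemma H_surj: "v \<in> E \<Longrightarrow> v \<in> (*v) H ` E"
proof -
  have "inj_on ((*v) H) E"
  proof (rule inj_onI)
    fix x y assume xy: "x \<in> E" "y \<in> E" "H *v x = H *v y"
    then have "x - y \<in> E" "(H *v (x - y)) \<bullet> (x - y) = 0"
      by (auto simp: matrix_vector_mult_diff_distrib)
    then show "x = y" using H_pos[of "x - y"] by fastforce
  qed
  then have "dim ((*v) H ` E) = dim E"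
    by (intro dim_image_eq) (auto simp: span_eq_iff[THEN iffD2, OF block_space_subspace])
  then have "(*v) H ` E = E"
    using H_maps
    by (intro subspace_dim_equal) (auto intro: block_space_subspace linear_subspace_image)
  then show "v \<in> E \<Longrightarrow> v \<in> (*v) H ` E" by simp
qed

lemma block_dual_norm_bound:
  assumes v: "v \<in> E" and d: "d \<in> E"
  shows "v \<bullet> d \<le> block_dual_norm blk i H v * block_norm H d"
proof -
  define w where "w = inv_into E ((*v) H) v"
  have w: "w \<in> E" "H *v w = v"
    using H_surj[OF v] by (auto simp: w_def inv_into_into f_inv_into_f)
  have "block_dual_norm blk i H v = block_norm H w"
    using w by (simp add: block_dual_norm_def block_norm_def inner_commute flip: w_def)
  then show ?thesis
    using H_Cauchy_Schwarz[OF w(1) d] w by simp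
qed

text \<open>Only used to see that the supremum in the definition of the operator norm is finite.\<close>

lemma block_norm_dominates: obtains c where "0 < c" "\<And>d. d \<in> E \<Longrightarrow> norm d \<le> c * block_norm H d"
proof (cases "E \<inter> sphere 0 1 = {}")
  case True
  have "norm d \<le> 1 * block_norm H d" if "d \<in> E" for d
  proof (cases "d = 0")
    case False
    then have "(1 / norm d) *\<^sub>R d \<in> E \<inter> sphere 0 1"
      using that by auto
    then show ?thesis using True by blast
  qed (simp add: block_norm_def)
  then show ?thesis by (intro that[of 1]) auto
next
  case False
  have "compact (E \<inter> sphere 0 1)"
    by (intro closed_Int_compact closed_subspace block_space_subspace compact_sphere)
  moreover have "continuous_on (E \<inter> sphere 0 1) (\<lambda>d. block_norm H d)"
    unfolding block_norm_def by (intro continuous_intros matrix_vector_mult_linear_continuous_on)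
  ultimately obtain m where m: "m \<in> E" "norm m = 1"
    "\<And>d. d \<in> E \<Longrightarrow> norm d = 1 \<Longrightarrow> block_norm H m \<le> block_norm H d"
    using continuous_attains_inf[OF _ False, of "block_norm H"] by auto
  have pos: "0 < block_norm H m" using m block_norm_pos[of m] by fastforce
  have "norm d \<le> (1 / block_norm H m) * block_norm H d" if d: "d \<in> E" for d
  proof (cases "d = 0")
    case False
    have e: "(1 / norm d) *\<^sub>R d \<in> E"
      using d by auto
    have "block_norm H m \<le> block_norm H ((1 / norm d) *\<^sub>R d)"
      using False e by (intro m(3)) auto
    also have "\<dots> = block_norm H d / norm d"
      using d by (subst block_norm_scale) auto
    finally show ?thesis
      using False pos by (simp add: field_simps)
  qed (simp add: block_norm_def)
  then show ?thesis using pos by (intro that[of "1 / block_norm H m"]) auto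
qed

lemma block_opnorm_bdd:
  fixes A :: "real^'p^'m::finite"
  shows "bdd_above ((\<lambda>d. norm (A *v d)) ` {d \<in> E. block_norm H d \<le> 1})"
proof -
  obtain c where c: "0 < c" "\<And>d. d \<in> E \<Longrightarrow> norm d \<le> c * block_norm H d"
    using block_norm_dominates by blast
  have "norm (A *v d) \<le> onorm ((*v) A) * c" if "d \<in> E" "block_norm H d \<le> 1" for d
  proof -
    have "norm d \<le> c * 1"
      using c(2)[OF that(1)] that(2) c(1) by (meson less_imp_le mult_left_mono order_trans)
    then have "onorm ((*v) A) * norm d \<le> onorm ((*v) A) * c"
      using onorm_pos_le[OF matrix_vector_mul_bounded_linear[of A]]
      by (intro mult_left_mono) auto
    then show ?thesis
      using onorm[OF matrix_vector_mul_bounded_linear[of A], of d] by linarith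
  qed
  then show ?thesis by (auto intro!: bdd_aboveI)
qed

lemma block_opnorm_bound:
  fixes A :: "real^'p^'m::finite"
  assumes d: "d \<in> E"
  shows "norm (A *v d) \<le> block_opnorm blk i H A * block_norm H d"
proof (cases "d = 0")
  case False
  then have pos: "0 < block_norm H d" using d block_norm_pos by auto
  let ?e = "(1 / block_norm H d) *\<^sub>R d"
  have "?e \<in> {d \<in> E. block_norm H d \<le> 1}"
    using d pos by (auto simp: block_norm_scale)
  from cSUP_upper[OF this block_opnorm_bdd[of A]]
  have "norm (A *v ?e) \<le> block_opnorm blk i H A"
    by (simp add: block_opnorm_def)
  then show ?thesis using pos by (simp add: matrix_vector_mult_scaleR field_simps)
qed (simp add: block_norm_def)

end

section \<open>Convexity tools\<close>

text \<open>
  Strong convexity in the form in which it is used twice: for the dual maximizer, with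
  \<open>N y = \<parallel>y - ydot\<parallel>\<^sup>2\<close>, and for the prox step, with \<open>N\<close> a shifted squared block norm.  Moving from the
  minimizer towards \<open>x\<close> by a fraction \<open>s\<close> cannot decrease the objective; divide by \<open>s\<close> and let
  \<open>s\<close> tend to 0.
\<close>

lemma minimizer_quadratic_growth:
  fixes \<phi> N :: "'a::real_vector \<Rightarrow> real"
  assumes conv: "convex_on S \<phi>" and z: "z \<in> S" and x: "x \<in> S"
    and quad: "\<And>s. N ((1 - s) *\<^sub>R z + s *\<^sub>R x) = (1 - s) * N z + s * N x - s * (1 - s) * D"
    and min: "\<And>u. u \<in> S \<Longrightarrow> \<phi> z + c * N z \<le> \<phi> u + c * N u"
    and c: "0 \<le> c"
  shows "\<phi> z + c * N z + c * D \<le> \<phi> x + c * N x"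
proof -
  have "r * (c * D) \<le> \<phi> x + c * N x - \<phi> z - c * N z" if r: "0 < r" "r < 1" for r
  proof -
    define s where "s = 1 - r"
    have s: "0 < s" "s < 1" using r by (auto simp: s_def)
    let ?u = "(1 - s) *\<^sub>R z + s *\<^sub>R x"
    have "?u \<in> S"
      using conv s z x unfolding convex_on_def convex_def by auto
    then have "\<phi> z + c * N z \<le> \<phi> ?u + c * N ?u" by (rule min)
    also have "\<phi> ?u \<le> (1 - s) * \<phi> z + s * \<phi> x"
      using s by (intro convex_onD[OF conv]) (auto simp: z x)
    finally have "\<phi> z + c * N z \<le> (1 - s) * \<phi> z + s * \<phi> x
        + c * ((1 - s) * N z + s * N x - s * (1 - s) * D)"
      unfolding quad by simp
    then have "s * ((1 - s) * (c * D)) \<le> s * (\<phi> x + c * N x - \<phi> z - c * N z)"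
      by (simp add: algebra_simps)
    then have "(1 - s) * (c * D) \<le> \<phi> x + c * N x - \<phi> z - c * N z"
      using s(1) by (rule mult_left_le_imp_le)
    then show ?thesis by (simp add: s_def)
  qed
  from field_le_mult_one_interval[OF this]
  show ?thesis by linarith
qed

lemma norm_sq_convex_comb:
  fixes x y a :: "'a::real_inner"
  shows "(norm ((1 - s) *\<^sub>R x + s *\<^sub>R y - a))\<^sup>2
    = (1 - s) * (norm (x - a))\<^sup>2 + s * (norm (y - a))\<^sup>2 - s * (1 - s) * (norm (y - x))\<^sup>2"
  by (simp add: power2_norm_eq_inner inner_add_left inner_add_right inner_diff_left
      inner_diff_right inner_commute algebra_simps)

lemma gradient_GDERIV:
  fixes f :: "'a::euclidean_space \<Rightarrow> real"
  assumes "f differentiable (at x)"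
  shows "GDERIV f x :> gradient f x"
proof -
  obtain f' where f': "(f has_derivative f') (at x)"
    using assms by (auto simp: differentiable_def)
  define D where "D = (\<Sum>b\<in>Basis. f' b *\<^sub>R b)"
  have lin: "linear f'" using f' by (rule has_derivative_linear)
  have "f' v = v \<bullet> D" for v
  proof -
    have "f' v = f' (\<Sum>b\<in>Basis. (v \<bullet> b) *\<^sub>R b)"
      unfolding euclidean_representation ..
    also have "\<dots> = (\<Sum>b\<in>Basis. (v \<bullet> b) * f' b)"
      by (simp only: linear_sum[OF lin] linear_cmul[OF lin] real_scaleR_def)
    also have "\<dots> = v \<bullet> D"
      unfolding D_def inner_sum_right inner_scaleR_right by (intro sum.cong refl mult.commute)
    finally show ?thesis .
  qed
  then have "f' = (\<lambda>v. v \<bullet> D)" by auto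
  with f' have D: "GDERIV f x :> D"
    by (simp add: gderiv_def)
  have unique: "E = D" if "GDERIV f x :> E" for E
  proof -
    have "(\<lambda>v. v \<bullet> E) = (\<lambda>v. v \<bullet> D)"
      using that D unfolding gderiv_def by (rule has_derivative_unique)
    then have "v \<bullet> (E - D) = 0" for v
      by (simp add: inner_diff_right fun_eq_iff)
    from this[of "E - D"] show ?thesis by simp
  qed
  have "(THE D. GDERIV f x :> D) = D"
    using D unique by (rule the_equality)
  with D show ?thesis by (simp add: gradient_def)
qed

lemma GDERIV_along_line:
  assumes "GDERIV f (x + t *\<^sub>R d) :> D"
  shows "((\<lambda>s. f (x + s *\<^sub>R d)) has_real_derivative (d \<bullet> D)) (at t)"
proof -
  have "((\<lambda>s. x + s *\<^sub>R d) has_derivative (\<lambda>s. s *\<^sub>R d)) (at t)"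
    by (auto intro!: derivative_eq_intros)
  from has_derivative_compose[OF this assms[unfolded gderiv_def]]
  show ?thesis
    by (simp add: has_field_derivative_def mult.commute[of "d \<bullet> D"] mult_commute_abs)
qed

lemma convex_above_gradient:
  fixes f :: "'a::real_inner \<Rightarrow> real"
  assumes "convex_on UNIV f" "GDERIV f x :> D"
  shows "f x + D \<bullet> (y - x) \<le> f y"
proof -
  let ?\<phi> = "\<lambda>t. f (x + t *\<^sub>R (y - x))"
  have "convex_on UNIV ?\<phi>"
  proof (rule convex_onI)
    fix t a b :: real
    assume t: "0 < t" "t < 1"
    have "x + ((1 - t) *\<^sub>R a + t *\<^sub>R b) *\<^sub>R (y - x)
        = (1 - t) *\<^sub>R (x + a *\<^sub>R (y - x)) + t *\<^sub>R (x + b *\<^sub>R (y - x))"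
      by (simp add: algebra_simps)
    then show "?\<phi> ((1 - t) *\<^sub>R a + t *\<^sub>R b) \<le> (1 - t) * ?\<phi> a + t * ?\<phi> b"
      using convex_onD[OF assms(1), of t] t by simp
  qed simp
  moreover have "(?\<phi> has_real_derivative ((y - x) \<bullet> D)) (at 0)"
    using assms(2) by (intro GDERIV_along_line) simp
  ultimately have "((y - x) \<bullet> D) * (1 - 0) \<le> ?\<phi> 1 - ?\<phi> 0"
    by (intro convex_on_imp_above_tangent[where A = UNIV]) auto
  then show ?thesis by (simp add: inner_commute)
qed

text \<open>
  The difference of the two sides, as a function of the length of the step along \<open>d\<close>, has nonpositive
  derivative.
\<close>

lemma directional_descent:
  fixes f :: "'a::real_inner \<Rightarrow> real"
  assumes grad: "\<And>x. GDERIV f x :> G x"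
    and lip: "\<And>t. 0 \<le> t \<Longrightarrow> t \<le> 1 \<Longrightarrow> (G (x + t *\<^sub>R d) - G x) \<bullet> d \<le> L * t"
  shows "f (x + d) \<le> f x + G x \<bullet> d + L / 2"
proof -
  let ?\<phi> = "\<lambda>t. f (x + t *\<^sub>R d) - t * (G x \<bullet> d) - L * t\<^sup>2 / 2"
  have "?\<phi> 1 \<le> ?\<phi> 0"
  proof (rule DERIV_nonpos_imp_nonincreasing[where f = ?\<phi>])
    fix t :: real assume t: "0 \<le> t" "t \<le> 1"
    have "(?\<phi> has_real_derivative (d \<bullet> G (x + t *\<^sub>R d) - G x \<bullet> d - L * t)) (at t)"
      by (auto intro!: derivative_eq_intros GDERIV_along_line[OF grad])
    moreover have "d \<bullet> G (x + t *\<^sub>R d) - G x \<bullet> d - L * t \<le> 0"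
      using lip[OF t] by (simp add: inner_diff_left inner_commute[of d])
    ultimately show "\<exists>y. (?\<phi> has_real_derivative y) (at t) \<and> y \<le> 0" by blast
  qed simp
  then show ?thesis by simp
qed

lemma pcc_convex_comb:
  assumes "proper_closed_convex \<phi>" "\<phi> x \<le> ereal r" "\<phi> y \<le> ereal s" "0 \<le> a" "a \<le> 1"
  shows "\<phi> ((1 - a) *\<^sub>R x + a *\<^sub>R y) \<le> ereal ((1 - a) * r + a * s)"
proof -
  have "convex {(x, r). \<phi> x \<le> ereal r}"
    using assms(1) by (simp add: proper_closed_convex_def)
  from convexD_alt[OF this, of "(x, r)" "(y, s)" a] assms show ?thesis by simp
qed

lemma pcc_real_convex_on: "proper_closed_convex (\<lambda>x. ereal (f x)) \<Longrightarrow> convex_on UNIV f"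
  using pcc_convex_comb[of "\<lambda>x. ereal (f x)" _ "f _" _ "f _"] by (intro convex_onI) auto

section \<open>Smoothing a Lipschitz convex function\<close>

text \<open>
  Inside this locale everything is real-valued: \<open>Y\<close> is the domain of the conjugate, on which
  \<open>hconj\<close> is its value; \<open>R\<close> is the dual radius, \<open>sm \<beta>\<close> the smoothed function and \<open>obj \<beta> u\<close> the
  function that is maximized over \<open>Y\<close> to get \<open>sm \<beta> u\<close>.
\<close>

locale lipschitz_smoothing =
  fixes h :: "'a::euclidean_space \<Rightarrow> real" and ydot :: 'a
  assumes h_pcc: "proper_closed_convex (\<lambda>u. ereal (h u))"
    and h_lip: "\<exists>K. K-lipschitz_on UNIV h"
begin

definition hconj :: "'a \<Rightarrow> real" where
  "hconj y = real_of_ereal (fenchel_conj (\<lambda>v. ereal (h v)) y)"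

definition Y :: "'a set" where "Y = effective_dom (fenchel_conj (\<lambda>v. ereal (h v)))"

definition R :: real where "R = real_of_ereal (dual_radius h ydot)"

definition sm :: "real \<Rightarrow> 'a \<Rightarrow> real" where "sm \<beta> u = real_of_ereal (smoothed h ydot \<beta> u)"

definition obj :: "real \<Rightarrow> 'a \<Rightarrow> 'a \<Rightarrow> real" where
  "obj \<beta> u y = u \<bullet> y - hconj y - \<beta> / 2 * (norm (y - ydot))\<^sup>2"

lemma fenchel_ge: "ereal (u \<bullet> y - h u) \<le> fenchel_conj (\<lambda>v. ereal (h v)) y"
  unfolding fenchel_conj_def by (rule SUP_upper2[of u]) auto

lemma fenchel_eq: "y \<in> Y \<Longrightarrow> fenchel_conj (\<lambda>v. ereal (h v)) y = ereal (hconj y)"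
  using fenchel_ge[of 0 y] unfolding Y_def effective_dom_def hconj_def
  by (cases "fenchel_conj (\<lambda>v. ereal (h v)) y") auto

lemma fenchel_notin: "y \<notin> Y \<Longrightarrow> fenchel_conj (\<lambda>v. ereal (h v)) y = \<infinity>"
  unfolding Y_def effective_dom_def by simp

lemma fenchel_young: "y \<in> Y \<Longrightarrow> u \<bullet> y - h u \<le> hconj y"
  using fenchel_ge[of u y] by (simp add: fenchel_eq)

lemma hconj_le:
  assumes "\<And>u. u \<bullet> y - h u \<le> r"
  shows "y \<in> Y" "hconj y \<le> r"
proof -
  have *: "fenchel_conj (\<lambda>v. ereal (h v)) y \<le> ereal r"
    unfolding fenchel_conj_def by (rule SUP_least) (use assms in auto)
  then show "y \<in> Y"
    unfolding Y_def effective_dom_def using le_less_trans[OF *, of \<infinity>] by simp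
  then show "hconj y \<le> r" using * by (simp add: fenchel_eq)
qed

lemma hconj_convex: "convex_on Y hconj"
proof -
  have comb: "u \<bullet> ((1 - t) *\<^sub>R x + t *\<^sub>R y) - h u \<le> (1 - t) * hconj x + t * hconj y"
    if "0 \<le> t" "t \<le> 1" "x \<in> Y" "y \<in> Y" for t x y u
  proof -
    have "u \<bullet> ((1 - t) *\<^sub>R x + t *\<^sub>R y) - h u = (1 - t) * (u \<bullet> x - h u) + t * (u \<bullet> y - h u)"
      by (simp add: inner_add_right algebra_simps)
    also have "\<dots> \<le> (1 - t) * hconj x + t * hconj y"
      using that by (intro add_mono mult_left_mono fenchel_young) auto
    finally show ?thesis .
  qed
  have "convex Y"
    unfolding convex_alt using hconj_le(1)[OF comb] by blast
  then show ?thesis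
    using hconj_le(2)[OF comb] by (intro convex_onI) auto
qed

text \<open>
  Half of the Fenchel-Moreau theorem, up to \<open>\<epsilon>\<close>.  A hyperplane that separates the epigraph
  from a point below it is not vertical, because \<open>h\<close> is finite everywhere, so its slope is an
  approximate subgradient.
\<close>

lemma h_approx_by_conj:
  assumes "0 < \<epsilon>"
  obtains y where "y \<in> Y" "h u - \<epsilon> \<le> u \<bullet> y - hconj y"
proof -
  let ?E = "{(x, r). ereal (h x) \<le> ereal r}"
  have "convex ?E" "closed ?E" "(u, h u - \<epsilon>) \<notin> ?E"
    using h_pcc assms by (auto simp: proper_closed_convex_def)
  from separating_hyperplane_closed_point[OF this] obtain a b where
    ab: "a \<bullet> (u, h u - \<epsilon>) < b" "\<And>z. z \<in> ?E \<Longrightarrow> b < a \<bullet> z"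
    by blast
  obtain a1 a2 where a: "a = (a1, a2)" by (cases a)
  have up: "a1 \<bullet> u + a2 * (h u - \<epsilon>) < b" "\<And>v. b < a1 \<bullet> v + a2 * h v"
    using ab(1) ab(2)[of "(v, h v)" for v] by (auto simp: a)
  have "a2 * \<epsilon> > 0"
    using up(1) up(2)[of u] by (simp add: algebra_simps)
  then have a2: "0 < a2" using assms by (simp add: zero_less_mult_iff)
  define y where "y = - (1 / a2) *\<^sub>R a1"
  have y: "v \<bullet> y = - (a1 \<bullet> v) / a2" for v
    by (simp add: y_def inner_commute)
  have bound: "v \<bullet> y - h v \<le> u \<bullet> y - h u + \<epsilon>" for v
  proof -
    have "a1 \<bullet> u + a2 * (h u - \<epsilon>) < a1 \<bullet> v + a2 * h v"
      using up by (rule less_trans)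
    then have "(a1 \<bullet> u + a2 * (h u - \<epsilon>)) / a2 \<le> (a1 \<bullet> v + a2 * h v) / a2"
      using a2 by (intro divide_right_mono) auto
    then show ?thesis using a2 unfolding y by (simp add: add_divide_distrib)
  qed
  show ?thesis
    using hconj_le[OF bound] by (intro that[of y]) auto
qed

lemma Y_nonempty: obtains y where "y \<in> Y"
  using h_approx_by_conj[of 1] by auto

text \<open>
  If \<open>\<parallel>y\<parallel>\<close> exceeds the Lipschitz constant, then \<open>u \<bullet> y - h u\<close> is unbounded along the ray of
  multiples \<open>u\<close> of \<open>y\<close>.
\<close>

lemma dual_radius_finite: "\<bar>dual_radius h ydot\<bar> \<noteq> \<infinity>"
proof -
  obtain K where K: "K-lipschitz_on UNIV h" using h_lip by blast
  have "norm y \<le> K" if y: "y \<in> Y" for y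
  proof (rule ccontr)
    assume "\<not> norm y \<le> K"
    then have pos: "0 < norm y * (norm y - K)"
      using lipschitz_on_nonneg[OF K] by (intro mult_pos_pos) auto
    obtain s where s: "hconj y + h 0 < of_nat s * (norm y * (norm y - K))"
      using reals_Archimedean3[OF pos] by auto
    have "h (real s *\<^sub>R y) \<le> h 0 + K * (real s * norm y)"
      using lipschitz_onD[OF K, of "real s *\<^sub>R y" 0] by (auto simp: dist_real_def)
    moreover have "(real s *\<^sub>R y) \<bullet> y - h (real s *\<^sub>R y) \<le> hconj y"
      by (rule fenchel_young[OF y])
    ultimately show False
      using s by (simp add: power2_norm_eq_inner[symmetric] power2_eq_square algebra_simps)
  qed
  then have "dual_radius h ydot \<le> ereal (K + norm ydot)"
    unfolding dual_radius_def Y_def[symmetric]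
    by (intro SUP_least) (auto intro: order_trans[OF norm_triangle_ineq4])
  moreover obtain y where "y \<in> Y" by (rule Y_nonempty)
  then have "ereal (norm (y - ydot)) \<le> dual_radius h ydot"
    unfolding dual_radius_def Y_def by (rule SUP_upper)
  ultimately show ?thesis
    by (cases "dual_radius h ydot") auto
qed

lemma dual_radius_eq: "dual_radius h ydot = ereal R"
  using dual_radius_finite by (simp add: R_def ereal_real)

lemma norm_le_R: "y \<in> Y \<Longrightarrow> norm (y - ydot) \<le> R"
proof -
  assume "y \<in> Y"
  then have "ereal (norm (y - ydot)) \<le> dual_radius h ydot"
    unfolding dual_radius_def Y_def by (rule SUP_upper)
  then show ?thesis by (simp add: dual_radius_eq)
qed

lemma smoothing_obj_eq: "y \<in> Y \<Longrightarrow> smoothing_obj h ydot \<beta> u y = ereal (obj \<beta> u y)"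
  by (simp add: smoothing_obj_def fenchel_eq obj_def)

lemma smoothing_obj_notin: "y \<notin> Y \<Longrightarrow> smoothing_obj h ydot \<beta> u y = -\<infinity>"
  by (simp add: smoothing_obj_def fenchel_notin)

lemma obj_le_h: "y \<in> Y \<Longrightarrow> obj \<beta> u y + \<beta> / 2 * (norm (y - ydot))\<^sup>2 \<le> h u"
  using fenchel_young[of y u] by (simp add: obj_def)

lemma smoothed_le:
  assumes "\<And>y. y \<in> Y \<Longrightarrow> obj \<beta> u y \<le> r"
  shows "smoothed h ydot \<beta> u \<le> ereal r"
  unfolding smoothed_def
proof (rule SUP_least)
  fix y show "smoothing_obj h ydot \<beta> u y \<le> ereal r"
    using assms by (cases "y \<in> Y") (auto simp: smoothing_obj_eq smoothing_obj_notin)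
qed

lemma smoothed_ge: "y \<in> Y \<Longrightarrow> ereal (obj \<beta> u y) \<le> smoothed h ydot \<beta> u"
  unfolding smoothed_def by (rule SUP_upper2[of y]) (auto simp: smoothing_obj_eq)

lemma smoothed_eq:
  assumes "0 \<le> \<beta>" shows "smoothed h ydot \<beta> u = ereal (sm \<beta> u)"
proof -
  obtain y where y: "y \<in> Y" by (rule Y_nonempty)
  have "smoothed h ydot \<beta> u \<le> ereal (h u)"
    using obj_le_h[of _ \<beta> u] assms by (intro smoothed_le) (smt (verit) mult_nonneg_nonneg zero_le_power2 divide_nonneg_pos)
  with smoothed_ge[OF y, of \<beta> u] show ?thesis
    by (cases "smoothed h ydot \<beta> u") (auto simp: sm_def)
qed

lemma sm_ge: "0 \<le> \<beta> \<Longrightarrow> y \<in> Y \<Longrightarrow> obj \<beta> u y \<le> sm \<beta> u"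
  using smoothed_ge[of y \<beta> u] by (simp add: smoothed_eq)

lemma sm_le: "0 \<le> \<beta> \<Longrightarrow> (\<And>y. y \<in> Y \<Longrightarrow> obj \<beta> u y \<le> r) \<Longrightarrow> sm \<beta> u \<le> r"
  using smoothed_le[of \<beta> u r] by (simp add: smoothed_eq)

lemma h_le_sm:
  assumes "0 \<le> \<beta>" shows "h u \<le> sm \<beta> u + \<beta> / 2 * R\<^sup>2"
proof (rule field_le_epsilon)
  fix e :: real assume "0 < e"
  then obtain y where y: "y \<in> Y" "h u - e \<le> u \<bullet> y - hconj y"
    by (rule h_approx_by_conj)
  have "\<beta> / 2 * (norm (y - ydot))\<^sup>2 \<le> \<beta> / 2 * R\<^sup>2"
    using norm_le_R[OF y(1)] assms by (intro mult_left_mono power_mono) auto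
  then show "h u \<le> sm \<beta> u + \<beta> / 2 * R\<^sup>2 + e"
    using y sm_ge[OF assms y(1), of u] by (simp add: obj_def)
qed

context
  fixes \<beta> u yh
  assumes \<beta>: "0 < \<beta>"
    and argmax: "is_arg_max (smoothing_obj h ydot \<beta> u) (\<lambda>y. True) yh"
begin

lemma argmax_le: "smoothing_obj h ydot \<beta> u y \<le> smoothing_obj h ydot \<beta> u yh"
  using argmax by (auto simp: is_arg_max_def not_less)

lemma argmax_in: "yh \<in> Y"
proof (rule ccontr)
  assume "yh \<notin> Y"
  moreover obtain y where "y \<in> Y" by (rule Y_nonempty)
  ultimately show False
    using argmax_le[of y] by (simp add: smoothing_obj_eq smoothing_obj_notin)
qed

lemma argmax_strong:
  assumes y: "y \<in> Y"
  shows "obj \<beta> u y + \<beta> / 2 * (norm (y - yh))\<^sup>2 \<le> obj \<beta> u yh"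
proof -
  have "(hconj yh - u \<bullet> yh) + \<beta> / 2 * (norm (yh - ydot))\<^sup>2 + \<beta> / 2 * (norm (y - yh))\<^sup>2
      \<le> (hconj y - u \<bullet> y) + \<beta> / 2 * (norm (y - ydot))\<^sup>2"
  proof (rule minimizer_quadratic_growth[where S = Y and \<phi> = "\<lambda>y. hconj y - u \<bullet> y"
        and N = "\<lambda>y. (norm (y - ydot))\<^sup>2"])
    have "concave_on Y (\<lambda>y. u \<bullet> y)"
      using hconj_convex unfolding concave_on_def
      by (intro convex_onI) (auto simp: inner_add_right convex_on_def)
    then show "convex_on Y (\<lambda>y. hconj y - u \<bullet> y)"
      by (rule convex_on_diff[OF hconj_convex])
    fix z assume "z \<in> Y"
    then show "hconj yh - u \<bullet> yh + \<beta> / 2 * (norm (yh - ydot))\<^sup>2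
        \<le> hconj z - u \<bullet> z + \<beta> / 2 * (norm (z - ydot))\<^sup>2"
      using argmax_le[of z] argmax_in by (simp add: smoothing_obj_eq obj_def)
  qed (use y \<beta> argmax_in norm_sq_convex_comb in auto)
  then show ?thesis by (simp add: obj_def)
qed

lemma sm_argmax: "sm \<beta> u = obj \<beta> u yh"
proof (rule antisym)
  show "sm \<beta> u \<le> obj \<beta> u yh"
  proof (rule sm_le)
    fix y assume "y \<in> Y"
    moreover have "0 \<le> \<beta> / 2 * (norm (y - yh))\<^sup>2" using \<beta> by simp
    ultimately show "obj \<beta> u y \<le> obj \<beta> u yh" using argmax_strong[of y] by linarith
  qed (use \<beta> in auto)
qed (use sm_ge argmax_in \<beta> in auto)

lemma argmax_unique:
  assumes "is_arg_max (smoothing_obj h ydot \<beta> u) (\<lambda>y. True) y"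
  shows "y = yh"
proof -
  have le: "smoothing_obj h ydot \<beta> u yh \<le> smoothing_obj h ydot \<beta> u y"
    using assms by (auto simp: is_arg_max_def not_less)
  then have "y \<in> Y"
    using argmax_in by (cases "y \<in> Y") (simp_all add: smoothing_obj_eq smoothing_obj_notin)
  with le have "obj \<beta> u yh \<le> obj \<beta> u y"
    using argmax_in by (simp add: smoothing_obj_eq)
  with argmax_strong[OF \<open>y \<in> Y\<close>] have "\<beta> * (norm (y - yh))\<^sup>2 \<le> 0" by simp
  then show ?thesis using \<beta> by (simp add: mult_le_0_iff)
qed

text \<open>
  Smoothness of \<open>sm \<beta>\<close> with constant \<open>1 / \<beta>\<close>, obtained without differentiating it: perturbing \<open>u\<close>
  by \<open>v\<close> adds a linear term to a strongly concave maximization problem.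
\<close>

lemma sm_descent: "sm \<beta> (u + v) \<le> sm \<beta> u + yh \<bullet> v + (norm v)\<^sup>2 / (2 * \<beta>)"
proof (rule sm_le)
  fix y assume y: "y \<in> Y"
  have "0 \<le> (norm (v - \<beta> *\<^sub>R (y - yh)))\<^sup>2" by simp
  also have "\<dots> = (norm v)\<^sup>2 - 2 * \<beta> * (v \<bullet> (y - yh)) + \<beta>\<^sup>2 * (norm (y - yh))\<^sup>2"
    unfolding power2_norm_eq_inner
    by (simp add: inner_diff_left inner_diff_right inner_commute power2_eq_square algebra_simps)
  finally have "v \<bullet> (y - yh) \<le> (norm v)\<^sup>2 / (2 * \<beta>) + \<beta> / 2 * (norm (y - yh))\<^sup>2"
    using \<beta> by (simp add: field_simps power2_eq_square)
  moreover have "obj \<beta> (u + v) y = obj \<beta> u y + v \<bullet> yh + v \<bullet> (y - yh)"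
    by (simp add: obj_def inner_add_left inner_diff_right)
  ultimately show "obj \<beta> (u + v) y \<le> sm \<beta> u + yh \<bullet> v + (norm v)\<^sup>2 / (2 * \<beta>)"
    using argmax_strong[OF y] by (simp add: sm_argmax inner_commute)
qed (use \<beta> in auto)

text \<open>
  The maximizer for \<open>\<beta>\<close> at \<open>u\<close> is a candidate in the maximization problems that define \<open>sm \<beta>' w\<close>
  and \<open>h w\<close>; this is the content of this lemma and of the next.
\<close>

lemma sm_linearization_le_sm:
  assumes "0 \<le> \<beta>'"
  shows "sm \<beta> u + yh \<bullet> (w - u) + (\<beta> - \<beta>') / 2 * (norm (yh - ydot))\<^sup>2 \<le> sm \<beta>' w"
  using sm_ge[OF assms argmax_in, of w]
  by (simp add: sm_argmax obj_def inner_diff_right inner_commute field_simps)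

lemma sm_linearization_le_h:
  "sm \<beta> u + yh \<bullet> (w - u) + \<beta> / 2 * (norm (yh - ydot))\<^sup>2 \<le> h w"
  using fenchel_young[OF argmax_in, of w]
  by (simp add: sm_argmax obj_def inner_diff_right inner_commute field_simps)

text \<open>
  A refinement of \<open>h_le_sm\<close> that is better when the maximizer is close to the centre \<open>ydot\<close>: strong
  concavity penalizes every dual point that is far from the maximizer.
\<close>

lemma h_le_sm_argmax:
  "h u \<le> sm \<beta> u + \<beta> / 2 * (2 * R * norm (yh - ydot) - (norm (yh - ydot))\<^sup>2)"
proof (rule field_le_epsilon)
  fix e :: real assume "0 < e"
  then obtain y where y: "y \<in> Y" "h u - e \<le> u \<bullet> y - hconj y"
    by (rule h_approx_by_conj)
  let ?N = "norm (yh - ydot)"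
  have "(y - ydot) \<bullet> (yh - ydot) \<le> R * ?N"
    using norm_cauchy_schwarz[of "y - ydot" "yh - ydot"] norm_le_R[OF y(1)]
    by (meson mult_right_mono norm_ge_zero order_trans)
  moreover have "(norm (y - ydot))\<^sup>2 - (norm (y - yh))\<^sup>2 = 2 * ((y - ydot) \<bullet> (yh - ydot)) - ?N\<^sup>2"
    unfolding power2_norm_eq_inner by (simp add: inner_diff_left inner_diff_right inner_commute)
  ultimately have "\<beta> / 2 * ((norm (y - ydot))\<^sup>2 - (norm (y - yh))\<^sup>2) \<le> \<beta> / 2 * (2 * R * ?N - ?N\<^sup>2)"
    using \<beta> by (intro mult_left_mono) auto
  moreover have "u \<bullet> y - hconj y = obj \<beta> u y + \<beta> / 2 * (norm (y - ydot))\<^sup>2"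
    by (simp add: obj_def)
  ultimately show "h u \<le> sm \<beta> u + \<beta> / 2 * (2 * R * ?N - ?N\<^sup>2) + e"
    using y(2) argmax_strong[OF y(1)] by (simp add: sm_argmax right_diff_distrib)
qed

end

end

section \<open>One step of the method\<close>

text \<open>
  \<open>gdom i\<close> is the set where the block function \<open>gb i\<close> is finite, and \<open>gbr\<close>, \<open>gr\<close> are the real values of
  \<open>gb\<close> and \<open>g\<close>.  They are total functions; their values outside the domains do not matter.
\<close>

locale composite_problem = lipschitz_smoothing h ydot
  for h :: "real^'m::finite \<Rightarrow> real" and ydot :: "real^'m" +
  fixes blk :: "'p::finite \<Rightarrow> 'n::finite"
    and H :: "'n \<Rightarrow> real^'p^'p"
    and f :: "real^'p \<Rightarrow> real"
    and g :: "real^'p \<Rightarrow> ereal"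
    and gb :: "'n \<Rightarrow> real^'p \<Rightarrow> ereal"
    and A :: "real^'p^'m"
    and Lhat :: "'n \<Rightarrow> real"
  assumes H_spd: "\<And>i. block_spd blk i (H i)"
    and f_pcc: "proper_closed_convex (\<lambda>x. ereal (f x))"
    and g_pcc: "proper_closed_convex g"
    and f_diff: "\<And>x. f differentiable (at x)"
    and f_block_smooth: "\<And>i x d. d \<in> block_space blk i \<Longrightarrow>
         block_dual_norm blk i (H i)
           (block_part blk i (gradient f (x + d)) - block_part blk i (gradient f x))
         \<le> Lhat i * block_norm (H i) d"
    and g_separable: "\<And>x. g x = (\<Sum>i\<in>UNIV. gb i (block_part blk i x))"
    and gb_values: "\<And>i z. z \<in> block_space blk i \<Longrightarrow> gb i z \<noteq> -\<infinity>"
begin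

lemma spd: "spd_block blk i (H i)"
  by unfold_locales (rule H_spd)

abbreviation P where "P i x \<equiv> block_part blk i x"

abbreviation bn where "bn i x \<equiv> block_norm (H i) x"

abbreviation opn where "opn i \<equiv> block_opnorm blk i (H i) A"

definition gdom :: "'n \<Rightarrow> (real^'p) set" where
  "gdom i = {z \<in> block_space blk i. gb i z \<noteq> \<infinity>}"

definition gbr :: "'n \<Rightarrow> real^'p \<Rightarrow> real" where "gbr i z = real_of_ereal (gb i z)"

definition gr :: "real^'p \<Rightarrow> real" where "gr x = (\<Sum>i\<in>UNIV. gbr i (P i x))"

lemma gb_eq: "z \<in> gdom i \<Longrightarrow> gb i z = ereal (gbr i z)"
  using gb_values[of z i] by (cases "gb i z") (auto simp: gdom_def gbr_def)

lemma g_eq: "(\<And>i. P i x \<in> gdom i) \<Longrightarrow> g x = ereal (gr x)"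
  unfolding g_separable gr_def by (simp add: gb_eq)

lemma g_finite_iff: "g x \<noteq> \<infinity> \<longleftrightarrow> (\<forall>i. P i x \<in> gdom i)"
  unfolding g_separable sum_Pinfty gdom_def by auto

lemma g_finite_block: "g x \<noteq> \<infinity> \<Longrightarrow> P i x \<in> gdom i"
  by (simp add: g_finite_iff)

lemma feasible_point: obtains x where "g x \<noteq> \<infinity>"
  using g_pcc by (auto simp: proper_closed_convex_def)

text \<open>
  Only \<open>g\<close> is assumed to be convex.  Fixing the other blocks at a feasible point makes \<open>gb i\<close>
  equal to \<open>g\<close> up to a constant.
\<close>

lemma gbr_convex: "convex_on (gdom i) (gbr i)"
proof -
  obtain x where x: "g x \<noteq> \<infinity>" by (rule feasible_point)
  define e where "e z = x + 1 *\<^sub>R (z - P i x)" for z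
  have Pe: "P j (e z) = (if j = i then z else P j x)" if "z \<in> block_space blk i" for j z
    using block_part_update[OF that, of j x 1] by (simp add: e_def)
  have fin: "g (e z) \<noteq> \<infinity> \<longleftrightarrow> z \<in> gdom i" if "z \<in> block_space blk i" for z
    using x that by (auto simp: g_finite_iff Pe)
  have gre: "gr (e z) = gbr i z + (\<Sum>j\<in>UNIV - {i}. gbr j (P j x))" if "z \<in> block_space blk i" for z
    unfolding gr_def using that by (subst sum.remove[of _ i]) (auto simp: Pe intro!: sum.cong)
  have comb: "(1 - t) *\<^sub>R z + t *\<^sub>R w \<in> gdom i \<and>
      gbr i ((1 - t) *\<^sub>R z + t *\<^sub>R w) \<le> (1 - t) * gbr i z + t * gbr i w"
    if t: "0 \<le> t" "t \<le> 1" and zw: "z \<in> gdom i" "w \<in> gdom i" for t z w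
  proof -
    have sp: "z \<in> block_space blk i" "w \<in> block_space blk i"
      "(1 - t) *\<^sub>R z + t *\<^sub>R w \<in> block_space blk i" (is "?u \<in> _")
      using zw by (auto simp: gdom_def)
    have "e ?u = (1 - t) *\<^sub>R e z + t *\<^sub>R e w"
      by (simp add: e_def algebra_simps)
    moreover have "g (e z) = ereal (gr (e z))" "g (e w) = ereal (gr (e w))"
      using zw sp fin by (auto intro!: g_eq simp: g_finite_iff)
    ultimately have le: "g (e ?u) \<le> ereal ((1 - t) * gr (e z) + t * gr (e w))"
      using t by (auto intro!: pcc_convex_comb[OF g_pcc])
    then have "g (e ?u) \<noteq> \<infinity>" by auto
    then have "?u \<in> gdom i" using fin sp by blast
    moreover have "g (e ?u) = ereal (gr (e ?u))"
      using \<open>g (e ?u) \<noteq> \<infinity>\<close> by (intro g_eq g_finite_block)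
    ultimately show ?thesis
      using le sp by (simp add: gre algebra_simps)
  qed
  have "convex (gdom i)" unfolding convex_alt using comb by blast
  then show ?thesis using comb by (intro convex_onI) auto
qed

text \<open>
  A convex combination whose weights have not been normalized; it also covers \<open>a + b = 0\<close>.
\<close>

lemma epigraph_combination:
  assumes "0 \<le> a" "0 \<le> b" "g x \<le> ereal r" "g y \<le> ereal s"
  obtains w u where "a *\<^sub>R x + b *\<^sub>R y = (a + b) *\<^sub>R w" "a * r + b * s = (a + b) * u" "g w \<le> ereal u"
proof (cases "a + b = 0")
  case True
  then have "a = 0" "b = 0" using assms by auto
  then show ?thesis using assms by (intro that[of x r]) auto
next
  case False
  then have pos: "0 < a + b" using assms by auto
  let ?t = "b / (a + b)"
  have t: "0 \<le> ?t" "?t \<le> 1" "(a + b) * (1 - ?t) = a" "(a + b) * ?t = b"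
    using assms pos by (auto simp: right_diff_distrib)
  show ?thesis
  proof (rule that)
    show "g ((1 - ?t) *\<^sub>R x + ?t *\<^sub>R y) \<le> ereal ((1 - ?t) * r + ?t * s)"
      using t assms by (intro pcc_convex_comb[OF g_pcc])
    show "a *\<^sub>R x + b *\<^sub>R y = (a + b) *\<^sub>R ((1 - ?t) *\<^sub>R x + ?t *\<^sub>R y)"
      unfolding scaleR_add_right scaleR_scaleR t ..
    show "a * r + b * s = (a + b) * ((1 - ?t) * r + ?t * s)"
      unfolding distrib_left mult.assoc[symmetric] t ..
  qed
qed

lemma f_convex: "convex_on UNIV f"
  by (rule pcc_real_convex_on[OF f_pcc])

lemma f_gradient: "GDERIV f x :> gradient f x"
  by (rule gradient_GDERIV[OF f_diff])

lemma f_block_descent: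
  assumes d: "d \<in> block_space blk i"
  shows "f (x + d) \<le> f x + gradient f x \<bullet> d + Lhat i / 2 * (bn i d)\<^sup>2"
proof -
  interpret s: spd_block blk i "H i" by (rule spd)
  have "f (x + d) \<le> f x + gradient f x \<bullet> d + (Lhat i * (bn i d)\<^sup>2) / 2"
  proof (rule directional_descent[OF f_gradient])
    fix t :: real assume t: "0 \<le> t" "t \<le> 1"
    let ?v = "P i (gradient f (x + t *\<^sub>R d)) - P i (gradient f x)"
    have "(gradient f (x + t *\<^sub>R d) - gradient f x) \<bullet> d = ?v \<bullet> d"
      using d by (simp add: inner_diff_left inner_block_part)
    also have "\<dots> \<le> block_dual_norm blk i (H i) ?v * bn i d"
      using d by (intro s.block_dual_norm_bound) auto
    also have "\<dots> \<le> (Lhat i * bn i (t *\<^sub>R d)) * bn i d"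
      using d by (intro mult_right_mono f_block_smooth) auto
    also have "\<dots> = Lhat i * (bn i d)\<^sup>2 * t"
      using d t by (simp add: s.block_norm_scale power2_eq_square)
    finally show "(gradient f (x + t *\<^sub>R d) - gradient f x) \<bullet> d \<le> Lhat i * (bn i d)\<^sup>2 * t" .
  qed
  then show ?thesis by simp
qed

lemma smoothed_block_descent:
  assumes \<beta>: "0 < \<beta>" and yh: "is_arg_max (smoothing_obj h ydot \<beta> (A *v x)) (\<lambda>y. True) yh"
    and d: "d \<in> block_space blk i"
  shows "f (x + d) + sm \<beta> (A *v (x + d))
    \<le> f x + sm \<beta> (A *v x) + (gradient f x + transpose A *v yh) \<bullet> d
      + (Lhat i + (opn i)\<^sup>2 / \<beta>) / 2 * (bn i d)\<^sup>2"
proof -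
  interpret s: spd_block blk i "H i" by (rule spd)
  have "(norm (A *v d))\<^sup>2 \<le> (opn i * bn i d)\<^sup>2"
    using s.block_opnorm_bound[OF d] by (intro power_mono) auto
  then have "(norm (A *v d))\<^sup>2 / (2 * \<beta>) \<le> (opn i * bn i d)\<^sup>2 / (2 * \<beta>)"
    using \<beta> by (intro divide_right_mono) auto
  then have "(norm (A *v d))\<^sup>2 / (2 * \<beta>) \<le> (opn i)\<^sup>2 / \<beta> / 2 * (bn i d)\<^sup>2"
    by (simp add: power_mult_distrib mult.commute)
  moreover have "sm \<beta> (A *v x + A *v d)
      \<le> sm \<beta> (A *v x) + yh \<bullet> (A *v d) + (norm (A *v d))\<^sup>2 / (2 * \<beta>)"
    by (rule sm_descent[OF \<beta> yh])
  ultimately show ?thesis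
    using f_block_descent[OF d, of x]
    by (simp add: inner_add_left dot_lmul_matrix matrix_vector_right_distrib algebra_simps add_divide_distrib)
qed

context
  fixes i c xhat xtil y z
  assumes c: "0 < c"
    and argmin: "is_arg_min (block_model blk H f gb A i c xhat xtil y)
      (\<lambda>z. z \<in> block_space blk i) z"
begin

lemma argmin_space: "z \<in> block_space blk i"
  using argmin by (simp add: is_arg_min_def)

lemma argmin_le:
  "w \<in> block_space blk i \<Longrightarrow>
    block_model blk H f gb A i c xhat xtil y z \<le> block_model blk H f gb A i c xhat xtil y w"
  using argmin by (auto simp: is_arg_min_def not_less)

lemma block_model_eq:
  assumes "w \<in> gdom i"
  shows "block_model blk H f gb A i c xhat xtil y w =
    ereal ((gradient f xhat + transpose A *v y) \<bullet> (w - P i xhat) + gbr i w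
      + c / 2 * (bn i (w - P i xtil))\<^sup>2)"
proof -
  have "w - P i xhat \<in> block_space blk i" using assms by (auto simp: gdom_def)
  then show ?thesis
    using assms by (simp add: block_model_def gb_eq inner_add_left inner_block_part)
qed

lemma argmin_in_gdom: "z \<in> gdom i"
proof -
  obtain x where "g x \<noteq> \<infinity>" by (rule feasible_point)
  then have w: "P i x \<in> gdom i" by (rule g_finite_block)
  then have "block_model blk H f gb A i c xhat xtil y z \<noteq> \<infinity>"
    using argmin_le[of "P i x"] by (auto simp: block_model_eq)
  then have "gb i z \<noteq> \<infinity>" by (auto simp: block_model_def)
  then show ?thesis using argmin_space by (simp add: gdom_def)
qed

lemma argmin_growth:
  assumes w: "w \<in> gdom i"
  defines "v \<equiv> gradient f xhat + transpose A *v y"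
  shows "v \<bullet> z + gbr i z + c / 2 * (bn i (z - P i xtil))\<^sup>2 + c / 2 * (bn i (w - z))\<^sup>2
    \<le> v \<bullet> w + gbr i w + c / 2 * (bn i (w - P i xtil))\<^sup>2"
proof -
  interpret s: spd_block blk i "H i" by (rule spd)
  show ?thesis
  proof (rule minimizer_quadratic_growth[where S = "gdom i" and \<phi> = "\<lambda>u. v \<bullet> u + gbr i u"
        and N = "\<lambda>u. (bn i (u - P i xtil))\<^sup>2"])
    have "convex_on (gdom i) (\<lambda>u. v \<bullet> u)"
      using gbr_convex[of i] by (intro convex_onI) (auto simp: inner_add_right convex_on_def)
    then show "convex_on (gdom i) (\<lambda>u. v \<bullet> u + gbr i u)"
      by (rule convex_on_add[OF _ gbr_convex])
    show "v \<bullet> z + gbr i z + c / 2 * (bn i (z - P i xtil))\<^sup>2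
        \<le> v \<bullet> u + gbr i u + c / 2 * (bn i (u - P i xtil))\<^sup>2" if u: "u \<in> gdom i" for u
    proof -
      have "u \<in> block_space blk i" using u by (simp add: gdom_def)
      from argmin_le[OF this] show ?thesis
        using u argmin_in_gdom by (simp add: block_model_eq v_def inner_diff_right)
    qed
    show "(bn i ((1 - s) *\<^sub>R z + s *\<^sub>R w - P i xtil))\<^sup>2
        = (1 - s) * (bn i (z - P i xtil))\<^sup>2 + s * (bn i (w - P i xtil))\<^sup>2
          - s * (1 - s) * (bn i (w - z))\<^sup>2" for s
    proof -
      have sp: "z - P i xtil \<in> block_space blk i" "w - P i xtil \<in> block_space blk i"
        using argmin_space w by (auto simp: gdom_def)
      have "(1 - s) *\<^sub>R z + s *\<^sub>R w - P i xtil = (1 - s) *\<^sub>R (z - P i xtil) + s *\<^sub>R (w - P i xtil)"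
        by (simp add: algebra_simps)
      then show ?thesis
        using s.block_norm_sq_convex_comb[OF sp] by simp
    qed
  qed (use c w argmin_in_gdom in auto)
qed

end

lemma argmin_unique:
  assumes c: "0 < c"
    and z: "is_arg_min (block_model blk H f gb A i c xhat xtil y) (\<lambda>z. z \<in> block_space blk i) z"
    and w: "is_arg_min (block_model blk H f gb A i c xhat xtil y) (\<lambda>z. z \<in> block_space blk i) w"
  shows "w = z"
proof -
  interpret s: spd_block blk i "H i" by (rule spd)
  have sp: "w - z \<in> block_space blk i"
    using argmin_space[OF c z] argmin_space[OF c w] by auto
  have neg: "bn i (z - w) = bn i (w - z)"
    using s.block_norm_scale[OF sp, of "-1"] by simp
  have "c / 2 * (bn i (w - z))\<^sup>2 + c / 2 * (bn i (w - z))\<^sup>2 \<le> 0"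
    using argmin_growth[OF c z argmin_in_gdom[OF c w]] argmin_growth[OF c w argmin_in_gdom[OF c z]]
    unfolding neg by linarith
  then have "c * (bn i (w - z))\<^sup>2 \<le> 0" by simp
  then have "bn i (w - z) = 0" using c by (simp add: mult_le_0_iff)
  then show ?thesis using s.block_norm_pos[OF sp] by fastforce
qed

text \<open>
  The basic inequality, averaged over the block drawn.  \<open>Gb\<close> is the value that represents \<open>g xbar\<close>.
  The averaging step moves block \<open>i\<close> with the expected weight \<open>\<tau> * q i / \<tau>0\<close>, which is larger than the
  \<open>\<tau>\<close> of the usual analysis unless \<open>q i = \<tau>0\<close>.  The excess multiplies the change of the prox
  objective, which is nonpositive.  That argument compares with the value at the old block, which has
  to be finite; this is the condition on \<open>gdom\<close>.

  The last term of the bound is what handles a negative initial gap in the first step.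
\<close>

lemma one_step:
  fixes \<tau> \<tau>0 \<beta> \<beta>' Gb :: real and q B :: "'n \<Rightarrow> real"
  assumes \<tau>: "0 < \<tau>" "\<tau> \<le> 1" and \<tau>0: "0 < \<tau>0" "\<And>i. \<tau>0 \<le> q i" and q: "(\<Sum>i\<in>UNIV. q i) = 1"
    and \<beta>': "0 < \<beta>'" and \<beta>: "\<beta> = (1 + \<tau>) * \<beta>'"
    and B: "\<And>i. B i = Lhat i + (opn i)\<^sup>2 / \<beta>'" "\<And>i. 0 < B i"
    and xhat: "xhat = (1 - \<tau>) *\<^sub>R xbar + \<tau> *\<^sub>R xtil"
    and yh: "is_arg_max (smoothing_obj h ydot \<beta>' (A *v xhat)) (\<lambda>y. True) yh"
    and z: "\<And>i. is_arg_min (block_model blk H f gb A i (\<tau> * B i / \<tau>0) xhat xtil yh)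
        (\<lambda>z. z \<in> block_space blk i) (z i)"
    and xs: "g xs \<noteq> \<infinity>"
    and fin: "\<And>i. P i xtil \<in> gdom i \<or> q i = \<tau>0"
  defines "xp i \<equiv> xhat + (\<tau> / \<tau>0) *\<^sub>R (z i - P i xtil)"
  shows "(\<Sum>i\<in>UNIV. q i * (f (xp i) + sm \<beta>' (A *v xp i)
        + ((1 - \<tau>) * Gb + \<tau> * gr xtil + \<tau> / \<tau>0 * (gbr i (z i) - gbr i (P i xtil)))))
    \<le> (1 - \<tau>) * (f xbar + sm \<beta> (A *v xbar) + Gb) + \<tau> * (f xs + gr xs + h (A *v xs))
      + (\<Sum>i\<in>UNIV. \<tau>\<^sup>2 * B i / (2 * \<tau>0) * ((bn i (P i xs - P i xtil))\<^sup>2 - (bn i (P i xs - z i))\<^sup>2))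
      - \<tau>\<^sup>2 * \<beta>' / 2 * (norm (yh - ydot))\<^sup>2"
proof -
  define v where "v = gradient f xhat + transpose A *v yh"
  define \<phi> where "\<phi> = f xhat + sm \<beta>' (A *v xhat)"
  define c where "c i = \<tau> * B i / \<tau>0" for i
  define T where "T i = v \<bullet> (z i - P i xtil) + gbr i (z i) - gbr i (P i xtil)
    + c i / 2 * (bn i (z i - P i xtil))\<^sup>2" for i
  define S where "S i = v \<bullet> (P i xs - P i xtil) + gbr i (P i xs) - gbr i (P i xtil)
    + c i / 2 * ((bn i (P i xs - P i xtil))\<^sup>2 - (bn i (P i xs - z i))\<^sup>2)" for i
  define N where "N = norm (yh - ydot)"
  have slack: "(1 - \<tau>) * (a + \<tau> * \<beta>' / 2 * N\<^sup>2) + \<tau> * (b - \<beta>' / 2 * N\<^sup>2) + (1 - \<tau>) * Gb + \<tau> * e + r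
    = (1 - \<tau>) * (a + Gb) + \<tau> * (b + e) + r - \<tau>\<^sup>2 * \<beta>' / 2 * N\<^sup>2" for a b e r
    by (simp add: field_simps power2_eq_square)
  have ac: "f xs + gr xs + h (A *v xs) = f xs + h (A *v xs) + gr xs" by simp
  have c: "0 < c i" for i using \<tau> \<tau>0(1) B(2)[of i] by (simp add: c_def)
  note z' = z[folded c_def]
  have zsp: "z i \<in> block_space blk i" for i by (rule argmin_space[OF c z'])
  have prox: "v \<bullet> z i + gbr i (z i) + c i / 2 * (bn i (z i - P i xtil))\<^sup>2 + c i / 2 * (bn i (w - z i))\<^sup>2
      \<le> v \<bullet> w + gbr i w + c i / 2 * (bn i (w - P i xtil))\<^sup>2" if "w \<in> gdom i" for w i
    unfolding v_def by (rule argmin_growth[OF c z' that])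
  have TS: "T i \<le> S i" for i
    using prox[OF g_finite_block[OF xs]] unfolding T_def S_def
    by (simp add: inner_diff_right algebra_simps)
  have T_scaled: "q i / \<tau>0 * T i \<le> T i" for i
  proof (cases "q i = \<tau>0")
    case False
    then have "P i xtil \<in> gdom i" using fin by blast
    from prox[OF this] have "T i + c i / 2 * (bn i (P i xtil - z i))\<^sup>2 \<le> 0"
      unfolding T_def by (simp add: inner_diff_right block_norm_def)
    moreover have "0 \<le> c i / 2 * (bn i (P i xtil - z i))\<^sup>2" using c[of i] by simp
    ultimately have "T i \<le> 0" by linarith
    moreover have "1 \<le> q i / \<tau>0" using \<tau>0 by simp
    ultimately show ?thesis using mult_right_mono_neg[of 1 "q i / \<tau>0" "T i"] by simp
  qed (use \<tau>0 in simp)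
  have summand_le: "f (xp i) + sm \<beta>' (A *v xp i)
      + ((1 - \<tau>) * Gb + \<tau> * gr xtil + \<tau> / \<tau>0 * (gbr i (z i) - gbr i (P i xtil)))
    \<le> \<phi> + (1 - \<tau>) * Gb + \<tau> * gr xtil + \<tau> / \<tau>0 * T i" for i
  proof -
    interpret s: spd_block blk i "H i" by (rule spd)
    let ?d = "(\<tau> / \<tau>0) *\<^sub>R (z i - P i xtil)"
    have d: "z i - P i xtil \<in> block_space blk i" using zsp by auto
    have "f (xp i) + sm \<beta>' (A *v xp i) \<le> \<phi> + v \<bullet> ?d + B i / 2 * (bn i ?d)\<^sup>2"
      unfolding xp_def \<phi>_def v_def B(1) using d by (intro smoothed_block_descent[OF \<beta>' yh]) auto
    also have "(bn i ?d)\<^sup>2 = (\<tau> / \<tau>0)\<^sup>2 * (bn i (z i - P i xtil))\<^sup>2"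
      using d by (simp add: s.block_norm_scale power_mult_distrib power_divide)
    also have "B i / 2 * ((\<tau> / \<tau>0)\<^sup>2 * (bn i (z i - P i xtil))\<^sup>2)
        = \<tau> / \<tau>0 * (c i / 2 * (bn i (z i - P i xtil))\<^sup>2)"
      by (simp add: c_def power2_eq_square mult_ac)
    finally show ?thesis by (simp add: T_def algebra_simps)
  qed
  have "(\<Sum>i\<in>UNIV. q i * (f (xp i) + sm \<beta>' (A *v xp i)
        + ((1 - \<tau>) * Gb + \<tau> * gr xtil + \<tau> / \<tau>0 * (gbr i (z i) - gbr i (P i xtil)))))
    \<le> (\<Sum>i\<in>UNIV. q i * (\<phi> + (1 - \<tau>) * Gb + \<tau> * gr xtil + \<tau> / \<tau>0 * T i))"
    using \<tau>0 by (intro sum_mono mult_left_mono summand_le) (meson less_imp_le order_trans)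
  also have "\<dots> = (\<phi> + (1 - \<tau>) * Gb + \<tau> * gr xtil) + \<tau> * (\<Sum>i\<in>UNIV. q i / \<tau>0 * T i)"
  proof -
    have "(\<Sum>i\<in>UNIV. q i * (\<phi> + (1 - \<tau>) * Gb + \<tau> * gr xtil + \<tau> / \<tau>0 * T i))
        = (\<Sum>i\<in>UNIV. q i * (\<phi> + (1 - \<tau>) * Gb + \<tau> * gr xtil) + \<tau> * (q i / \<tau>0 * T i))"
      by (intro sum.cong refl) (simp add: distrib_left)
    also have "\<dots> = (\<Sum>i\<in>UNIV. q i) * (\<phi> + (1 - \<tau>) * Gb + \<tau> * gr xtil) + \<tau> * (\<Sum>i\<in>UNIV. q i / \<tau>0 * T i)"
      by (simp only: sum.distrib sum_distrib_left sum_distrib_right)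
    finally show ?thesis by (simp add: q)
  qed
  also have "(\<Sum>i\<in>UNIV. q i / \<tau>0 * T i) \<le> (\<Sum>i\<in>UNIV. S i)"
    by (intro sum_mono order_trans[OF T_scaled TS])
  also have "(\<Sum>i\<in>UNIV. S i) = v \<bullet> (xs - xtil) + gr xs - gr xtil
      + (\<Sum>i\<in>UNIV. c i / 2 * ((bn i (P i xs - P i xtil))\<^sup>2 - (bn i (P i xs - z i))\<^sup>2))"
  proof -
    have "(\<Sum>i\<in>UNIV. v \<bullet> (P i xs - P i xtil)) = v \<bullet> (xs - xtil)"
      unfolding inner_eq_sum_blocks[of v "xs - xtil" blk] block_part_diff ..
    then show ?thesis
      unfolding S_def gr_def by (simp only: sum.distrib sum_subtractf)
  qed
  also have "\<phi> + (1 - \<tau>) * Gb + \<tau> * gr xtil + \<tau> * (v \<bullet> (xs - xtil) + gr xs - gr xtil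
      + (\<Sum>i\<in>UNIV. c i / 2 * ((bn i (P i xs - P i xtil))\<^sup>2 - (bn i (P i xs - z i))\<^sup>2)))
    = (1 - \<tau>) * (\<phi> + v \<bullet> (xbar - xhat)) + \<tau> * (\<phi> + v \<bullet> (xs - xhat)) + (1 - \<tau>) * Gb + \<tau> * gr xs
      + (\<Sum>i\<in>UNIV. \<tau>\<^sup>2 * B i / (2 * \<tau>0) * ((bn i (P i xs - P i xtil))\<^sup>2 - (bn i (P i xs - z i))\<^sup>2))"
  proof -
    have "\<tau> * (c i / 2 * X) = \<tau>\<^sup>2 * B i / (2 * \<tau>0) * X" for i X
      by (simp add: c_def power2_eq_square)
    then have "\<tau> * (\<Sum>i\<in>UNIV. c i / 2 * ((bn i (P i xs - P i xtil))\<^sup>2 - (bn i (P i xs - z i))\<^sup>2))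
        = (\<Sum>i\<in>UNIV. \<tau>\<^sup>2 * B i / (2 * \<tau>0) * ((bn i (P i xs - P i xtil))\<^sup>2 - (bn i (P i xs - z i))\<^sup>2))"
      by (simp only: sum_distrib_left)
    moreover have "\<tau> * (v \<bullet> (xs - xtil)) = (1 - \<tau>) * (v \<bullet> (xbar - xhat)) + \<tau> * (v \<bullet> (xs - xhat))"
      by (simp add: xhat inner_diff_right inner_add_right algebra_simps)
    ultimately show ?thesis by (simp add: distrib_left right_diff_distrib left_diff_distrib)
  qed
  also have "(1 - \<tau>) * (\<phi> + v \<bullet> (xbar - xhat))
      \<le> (1 - \<tau>) * (f xbar + sm \<beta> (A *v xbar) + \<tau> * \<beta>' / 2 * N\<^sup>2)"
  proof (rule mult_left_mono)
    have "sm \<beta>' (A *v xhat) + yh \<bullet> (A *v xbar - A *v xhat) + (\<beta>' - \<beta>) / 2 * N\<^sup>2 \<le> sm \<beta> (A *v xbar)"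
      unfolding N_def using \<beta> \<beta>' \<tau> by (intro sm_linearization_le_sm[OF \<beta>' yh]) auto
    moreover have "f xhat + gradient f xhat \<bullet> (xbar - xhat) \<le> f xbar"
      by (rule convex_above_gradient[OF f_convex f_gradient])
    moreover have "(\<beta>' - \<beta>) / 2 * N\<^sup>2 = - (\<tau> * \<beta>' / 2 * N\<^sup>2)"
      by (simp add: \<beta> algebra_simps)
    ultimately show "\<phi> + v \<bullet> (xbar - xhat) \<le> f xbar + sm \<beta> (A *v xbar) + \<tau> * \<beta>' / 2 * N\<^sup>2"
      by (simp add: \<phi>_def v_def inner_add_left dot_lmul_matrix matrix_vector_mult_diff_distrib)
  qed (use \<tau> in auto)
  also have "\<tau> * (\<phi> + v \<bullet> (xs - xhat)) \<le> \<tau> * (f xs + h (A *v xs) - \<beta>' / 2 * N\<^sup>2)"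
  proof (rule mult_left_mono)
    have "sm \<beta>' (A *v xhat) + yh \<bullet> (A *v xs - A *v xhat) + \<beta>' / 2 * N\<^sup>2 \<le> h (A *v xs)"
      unfolding N_def by (rule sm_linearization_le_h[OF \<beta>' yh])
    moreover have "f xhat + gradient f xhat \<bullet> (xs - xhat) \<le> f xs"
      by (rule convex_above_gradient[OF f_convex f_gradient])
    ultimately show "\<phi> + v \<bullet> (xs - xhat) \<le> f xs + h (A *v xs) - \<beta>' / 2 * N\<^sup>2"
      by (simp add: \<phi>_def v_def inner_add_left dot_lmul_matrix matrix_vector_mult_diff_distrib)
  qed (use \<tau> in auto)
  finally show ?thesis
    unfolding N_def[symmetric] slack ac by this (use \<tau> in \<open>simp_all add: mult_left_mono\<close>)
qed

end

section \<open>Functions of finitely many random indices\<close>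

text \<open>
  Since all index values have positive probability, every finite history occurs at some point of the
  sample space.  Conditioning on a history is therefore evaluation at such a point:
  \<open>branch k \<omega> i\<close> is a point where the first \<open>k\<close> indices are those of \<open>\<omega>\<close> and the next one is \<open>i\<close>.
  Functions that are \<open>determined\<close> by finitely many indices are simple functions, which is where the
  measurability of the iterates comes from.
\<close>

locale random_indices = prob_space M for M :: "'w measure" +
  fixes idx :: "nat \<Rightarrow> 'w \<Rightarrow> 'n::finite" and q :: "'n \<Rightarrow> real"
  assumes indep: "indep_vars (\<lambda>_. count_space UNIV) idx UNIV"
    and distr: "\<And>k i. prob {\<omega>\<in>space M. idx k \<omega> = i} = q i"
    and q_pos: "\<And>i. 0 < q i"
begin

definition agree :: "nat \<Rightarrow> 'w \<Rightarrow> 'w \<Rightarrow> bool" where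
  "agree k \<omega> \<omega>' \<longleftrightarrow> (\<forall>j<k. idx j \<omega> = idx j \<omega>')"

definition determined :: "nat \<Rightarrow> ('w \<Rightarrow> 'b) \<Rightarrow> bool" where
  "determined k V \<longleftrightarrow> (\<forall>\<omega>\<in>space M. \<forall>\<omega>'\<in>space M. agree k \<omega> \<omega>' \<longrightarrow> V \<omega> = V \<omega>')"

definition history :: "nat \<Rightarrow> (nat \<Rightarrow> 'n) \<Rightarrow> 'w set" where
  "history k s = {\<omega>\<in>space M. \<forall>j<k. idx j \<omega> = s j}"

lemma idx_measurable: "idx k \<in> measurable M (count_space UNIV)"
  using indep by (auto simp: indep_vars_def)

lemma history_event [measurable]: "history k s \<in> events"
proof -
  have ev: "idx j -` {s j} \<inter> space M \<in> events" for j
    by (rule measurable_sets[OF idx_measurable]) auto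
  have "(\<Inter>j\<in>{..<k}. idx j -` {s j} \<inter> space M) \<in> events" if "k \<noteq> 0"
    using that by (intro sets.finite_INT ev) auto
  moreover have "history k s = (if k = 0 then space M else (\<Inter>j\<in>{..<k}. idx j -` {s j} \<inter> space M))"
    by (auto simp: history_def)
  ultimately show ?thesis by simp
qed

lemma prob_history: "prob (history k s) = (\<Prod>j<k. q (s j))"
proof (cases "k = 0")
  case True
  then show ?thesis by (simp add: history_def prob_space)
next
  case False
  have eq: "idx j -` {s j} \<inter> space M = {\<omega>\<in>space M. idx j \<omega> = s j}" for j
    by auto
  have "prob (\<Inter>j\<in>{..<k}. idx j -` {s j} \<inter> space M)
      = (\<Prod>j\<in>{..<k}. prob (idx j -` {s j} \<inter> space M))"
    using False
    by (intro indep_varsD_finite[where M' = "\<lambda>_. count_space UNIV"] indep_vars_subset[OF indep]) auto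
  moreover have "history k s = (\<Inter>j\<in>{..<k}. idx j -` {s j} \<inter> space M)"
    using False by (auto simp: history_def)
  ultimately show ?thesis
    by (simp add: eq distr)
qed

lemma prob_history_pos: "0 < prob (history k s)"
  unfolding prob_history by (intro prod_pos) (simp add: q_pos)

definition witness :: "nat \<Rightarrow> (nat \<Rightarrow> 'n) \<Rightarrow> 'w" where
  "witness k s = (SOME \<omega>. \<omega> \<in> history k s)"

lemma witness: "witness k s \<in> history k s"
proof -
  have "history k s \<noteq> {}"
    using prob_history_pos[of k s] by auto
  then show ?thesis unfolding witness_def by (rule some_in_eq[THEN iffD2])
qed

lemma witness_space: "witness k s \<in> space M"
  using witness by (auto simp: history_def)

lemma idx_witness: "j < k \<Longrightarrow> idx j (witness k s) = s j"
  using witness[of k s] by (auto simp: history_def)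

definition branch :: "nat \<Rightarrow> 'w \<Rightarrow> 'n \<Rightarrow> 'w" where
  "branch k \<omega> i = witness (Suc k) ((\<lambda>j. idx j \<omega>)(k := i))"

lemma branch_space: "branch k \<omega> i \<in> space M"
  by (simp add: branch_def witness_space)

lemma branch_agree: "agree k (branch k \<omega> i) \<omega>"
  by (auto simp: agree_def branch_def idx_witness)

lemma branch_idx: "idx k (branch k \<omega> i) = i"
  by (simp add: branch_def idx_witness)

lemma agree_Suc: "agree (Suc k) \<omega> \<omega>' \<longleftrightarrow> agree k \<omega> \<omega>' \<and> idx k \<omega> = idx k \<omega>'"
  by (auto simp: agree_def less_Suc_eq)

lemma determinedD:
  "determined k V \<Longrightarrow> \<omega> \<in> space M \<Longrightarrow> \<omega>' \<in> space M \<Longrightarrow> agree k \<omega> \<omega>' \<Longrightarrow> V \<omega> = V \<omega>'"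
  by (auto simp: determined_def)

lemma determined_branch_sum:
  fixes V :: "'w \<Rightarrow> real"
  assumes V: "determined (Suc k) V"
  shows "determined k (\<lambda>\<omega>. \<Sum>i\<in>UNIV. q i * V (branch k \<omega> i))"
proof -
  have "V (branch k \<omega> i) = V (branch k \<omega>' i)" if "agree k \<omega> \<omega>'" for \<omega> \<omega>' i
    using that
    by (intro determinedD[OF V] branch_space)
       (auto simp: agree_Suc branch_idx agree_def branch_def idx_witness)
  then show ?thesis
    unfolding determined_def by (intro ballI impI sum.cong refl) simp
qed

abbreviation Histories :: "nat \<Rightarrow> (nat \<Rightarrow> 'n) set" where
  "Histories k \<equiv> {..<k} \<rightarrow>\<^sub>E UNIV"

lemma finite_Histories: "finite (Histories k)"
  by (intro finite_PiE) auto

lemma history_indicator_sum: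
  fixes c :: "(nat \<Rightarrow> 'n) \<Rightarrow> real"
  assumes "\<omega> \<in> space M"
  shows "(\<Sum>s\<in>Histories k. indicator (history k s) \<omega> * c s) = c (restrict (\<lambda>j. idx j \<omega>) {..<k})"
proof -
  let ?s = "restrict (\<lambda>j. idx j \<omega>) {..<k}"
  have "indicator (history k s) \<omega> * c s = (if s = ?s then c s else 0)" if "s \<in> Histories k" for s
  proof (cases "s = ?s")
    case True
    then show ?thesis using assms by (auto simp: history_def indicator_def)
  next
    case False
    have "\<exists>j<k. s j \<noteq> idx j \<omega>"
    proof (rule ccontr)
      assume "\<not> (\<exists>j<k. s j \<noteq> idx j \<omega>)"
      then have "s = ?s"
        using that by (intro extensionalityI[of s "{..<k}"]) (auto simp: PiE_def)
      with False show False by simp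
    qed
    then obtain j where "j < k" "s j \<noteq> idx j \<omega>" by blast
    then show ?thesis using False by (auto simp: history_def indicator_def)
  qed
  then have "(\<Sum>s\<in>Histories k. indicator (history k s) \<omega> * c s)
      = (\<Sum>s\<in>Histories k. if s = ?s then c s else 0)"
    by (intro sum.cong) auto
  also have "\<dots> = c ?s"
    using finite_Histories by (subst sum.delta) auto
  finally show ?thesis .
qed

lemma determined_expectation:
  fixes V :: "'w \<Rightarrow> real"
  assumes V: "determined k V"
  shows "integrable M V"
    and "expectation V = (\<Sum>s\<in>Histories k. prob (history k s) * V (witness k s))"
proof -
  let ?W = "\<lambda>\<omega>. \<Sum>s\<in>Histories k. indicator (history k s) \<omega> * V (witness k s)"
  have eq: "V \<omega> = ?W \<omega>" if \<omega>: "\<omega> \<in> space M" for \<omega>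
  proof -
    have "?W \<omega> = V (witness k (restrict (\<lambda>j. idx j \<omega>) {..<k}))"
      using \<omega> by (rule history_indicator_sum)
    also have "\<dots> = V \<omega>"
      using \<omega> by (intro determinedD[OF V] witness_space) (auto simp: agree_def idx_witness)
    finally show ?thesis by simp
  qed
  have "integrable M ?W"
    by (intro Bochner_Integration.integrable_sum integrable_mult_left integrable_real_indicator)
       (auto simp: emeasure_eq_measure)
  moreover have "integrable M V \<longleftrightarrow> integrable M ?W"
    by (intro Bochner_Integration.integrable_cong refl eq)
  ultimately show "integrable M V" by simp
  have "expectation V = expectation ?W"
    by (intro Bochner_Integration.integral_cong refl eq)
  also have "\<dots> = (\<Sum>s\<in>Histories k. prob (history k s) * V (witness k s))"
    by (subst Bochner_Integration.integral_sum)
       (auto intro!: integrable_mult_left integrable_real_indicator simp: emeasure_eq_measure)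
  finally show "expectation V = (\<Sum>s\<in>Histories k. prob (history k s) * V (witness k s))" .
qed

lemma expectation_condition_on_history:
  fixes V :: "'w \<Rightarrow> real"
  assumes V: "determined (Suc k) V"
  shows "expectation V = expectation (\<lambda>\<omega>. \<Sum>i\<in>UNIV. q i * V (branch k \<omega> i))"
proof -
  let ?c = "\<lambda>s i. V (branch k (witness k s) i)"
  let ?A = "\<lambda>s i. history (Suc k) (s(k := i))"
  have eq: "V \<omega> = (\<Sum>s\<in>Histories k. \<Sum>i\<in>UNIV. indicator (?A s i) \<omega> * ?c s i)"
    if \<omega>: "\<omega> \<in> space M" for \<omega>
  proof -
    let ?s = "restrict (\<lambda>j. idx j \<omega>) {..<k}"
    have "(\<Sum>i\<in>UNIV. indicator (?A s i) \<omega> * ?c s i) = indicator (history k s) \<omega> * ?c s (idx k \<omega>)" for s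
    proof -
      have "indicator (?A s i) \<omega> * ?c s i
          = (if i = idx k \<omega> then indicator (history k s) \<omega> * ?c s i else 0)" for i
        by (auto simp: history_def indicator_def less_Suc_eq)
      then show ?thesis by (simp add: sum.delta)
    qed
    then have "(\<Sum>s\<in>Histories k. \<Sum>i\<in>UNIV. indicator (?A s i) \<omega> * ?c s i) = ?c ?s (idx k \<omega>)"
      using history_indicator_sum[OF \<omega>, of k "\<lambda>s. ?c s (idx k \<omega>)"] by simp
    also have "\<dots> = V \<omega>"
      using \<omega> by (intro determinedD[OF V] branch_space)
        (auto simp: agree_def branch_def idx_witness less_Suc_eq)
    finally show ?thesis by simp
  qed
  have int: "integrable M (\<lambda>\<omega>. indicator (?A s i) \<omega> * ?c s i)" for s i
    by (intro integrable_mult_left integrable_real_indicator) (auto simp: emeasure_eq_measure)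
  have pA: "prob (?A s i) = prob (history k s) * q i" for s i
    unfolding prob_history by simp
  have "expectation V = expectation (\<lambda>\<omega>. \<Sum>s\<in>Histories k. \<Sum>i\<in>UNIV. indicator (?A s i) \<omega> * ?c s i)"
    by (intro Bochner_Integration.integral_cong refl eq)
  also have "\<dots> = (\<Sum>s\<in>Histories k. expectation (\<lambda>\<omega>. \<Sum>i\<in>UNIV. indicator (?A s i) \<omega> * ?c s i))"
    by (intro Bochner_Integration.integral_sum Bochner_Integration.integrable_sum int)
  also have "\<dots> = (\<Sum>s\<in>Histories k. \<Sum>i\<in>UNIV. expectation (\<lambda>\<omega>. indicator (?A s i) \<omega> * ?c s i))"
    by (intro sum.cong refl Bochner_Integration.integral_sum int)
  also have "\<dots> = (\<Sum>s\<in>Histories k. \<Sum>i\<in>UNIV. prob (?A s i) * ?c s i)"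
    using history_event sets.Int_space_eq2 by simp
  also have "\<dots> = (\<Sum>s\<in>Histories k. prob (history k s) * (\<Sum>i\<in>UNIV. q i * ?c s i))"
    by (simp add: pA sum_distrib_left mult.assoc)
  also have "\<dots> = expectation (\<lambda>\<omega>. \<Sum>i\<in>UNIV. q i * V (branch k \<omega> i))"
    by (rule determined_expectation(2)[OF determined_branch_sum[OF V], symmetric])
  finally show ?thesis .
qed

lemma expectation_step:
  fixes U V :: "'w \<Rightarrow> real"
  assumes U: "determined k U" and V: "determined (Suc k) V"
    and step: "\<And>\<omega>. \<omega> \<in> space M \<Longrightarrow> (\<Sum>i\<in>UNIV. q i * V (branch k \<omega> i)) \<le> c * U \<omega>"
  shows "expectation V \<le> c * expectation U"
proof -
  have "expectation V = expectation (\<lambda>\<omega>. \<Sum>i\<in>UNIV. q i * V (branch k \<omega> i))"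
    by (rule expectation_condition_on_history[OF V])
  also have "\<dots> \<le> expectation (\<lambda>\<omega>. c * U \<omega>)"
    by (intro integral_mono integrable_mult_right determined_expectation(1)[OF U]
        determined_expectation(1)[OF determined_branch_sum[OF V]] step)
  finally show ?thesis by simp
qed

end

section \<open>The step sizes\<close>

text \<open>
  The root equation determines \<open>y\<close> as \<open>x * (1 + x) / sqrt (1 - x\<^sup>2)\<close>, so both claims are bounds
  for a square root.
\<close>

lemma cubic_step_properties:
  fixes x y :: real
  assumes x: "0 < x" "x < 1" and y: "0 < y" "y \<le> 1"
    and root: "x^2 * (1 + x) = y^2 * (1 - x)"
  shows "y \<le> x * (1 + y)" and "x + x^2 + x^3 / 2 \<le> y"
proof -
  have "(y * (1 - x))^2 = y^2 * (1 - x) * (1 - x)"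
    by (simp add: power2_eq_square)
  also have "\<dots> = x^2 * (1 - x^2)"
    unfolding root[symmetric] by (simp add: power2_eq_square algebra_simps)
  also have "\<dots> \<le> x^2 * 1"
    by (intro mult_left_mono) auto
  finally have "(y * (1 - x))^2 \<le> x^2"
    by simp
  then have "y * (1 - x) \<le> x"
    by (rule power2_le_imp_le) (use x in simp)
  then show "y \<le> x * (1 + y)"
    by (simp add: algebra_simps)
  have "(1 + x + x^2 / 2)^2 * (1 - x) = 1 + x - x^3 - 3/4 * x^4 - x^5 / 4"
    by (simp add: field_simps eval_nat_numeral)
  also have "\<dots> \<le> 1 + x"
    using x zero_le_power[of x] by (smt (verit) divide_nonneg_pos mult_nonneg_nonneg)
  finally have "x^2 * ((1 + x + x^2 / 2)^2 * (1 - x)) \<le> x^2 * (1 + x)"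
    by (intro mult_left_mono) auto
  then have "(x * (1 + x + x^2 / 2))^2 * (1 - x) \<le> y^2 * (1 - x)"
    unfolding root by (simp add: power_mult_distrib mult.assoc)
  then have "(x * (1 + x + x^2 / 2))^2 \<le> y^2"
    using x by simp
  then have "x * (1 + x + x^2 / 2) \<le> y"
    by (rule power2_le_imp_le) (use y in simp)
  then show "x + x^2 + x^3 / 2 \<le> y"
    by (simp add: algebra_simps power2_eq_square power3_eq_cube)
qed

text \<open>
  Telescoping this inequality bounds \<open>\<Prod> (1 - \<tau>\<^sub>l\<^sup>2)\<close> from below.  For small step sizes
  \<open>- ln (1 - x\<^sup>2)\<close> is, up to terms of fourth order, the amount by which \<open>y - y\<^sup>2 / 4\<close> decreases in the
  step from \<open>y\<close> to \<open>x\<close>.  The function \<open>- ln ((5 - 2 * y) / (5 + 3 * y))\<close> begins with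
  \<open>y - y\<^sup>2 / 10\<close>; the smaller quadratic term leaves room for the inequality to hold for all step sizes.
\<close>

lemma cubic_step_potential:
  fixes x y :: real
  assumes x: "0 < x" "x < 1" and y: "0 < y" "y \<le> 1"
    and root: "x^2 * (1 + x) = y^2 * (1 - x)"
  shows "(5 - 2 * y) / (5 + 3 * y) \<le> (1 - x^2) * ((5 - 2 * x) / (5 + 3 * x))"
proof -
  have lo: "x + x^2 + x^3 / 2 \<le> y"
    using cubic_step_properties(2)[OF assms] .
  have "x + x^2 \<le> 1"
    using lo y x zero_less_power[of x 3] by linarith
  then have "x \<le> 4/5"
    using power_mono[of "4/5" x 2] by (cases "x \<le> 4/5") (auto simp: power2_eq_square)
  have c: "0 \<le> 25 - 15 * x^2 + 6 * x^3"
    using x power_le_one[of x 2] zero_less_power[of x 3] by linarith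
  (* After clearing denominators the claim is linear and increasing in y, so it suffices to insert
     the lower bound for y; the remaining difference is this polynomial. *)
  have "0 \<le> x^3 * (15/2 - 9 * x - 3/2 * x^2 + 3 * x^3)"
    using x \<open>x + x^2 \<le> 1\<close> \<open>x \<le> 4/5\<close> zero_less_power[of x 3]
    by (intro mult_nonneg_nonneg) auto
  then have "25 * x + 25 * x^2 - 10 * x^3 \<le> (x + x^2 + x^3 / 2) * (25 - 15 * x^2 + 6 * x^3)"
    by (simp add: algebra_simps power2_eq_square power3_eq_cube)
  also have "\<dots> \<le> y * (25 - 15 * x^2 + 6 * x^3)"
    using lo c by (intro mult_right_mono)
  finally have "(5 - 2 * y) * (5 + 3 * x) \<le> (1 - x^2) * (5 - 2 * x) * (5 + 3 * y)"
    by (simp add: algebra_simps power2_eq_square power3_eq_cube)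
  then show ?thesis
    using x y by (simp add: field_simps)
qed

text \<open>
  The products \<open>shrink\<close> and \<open>grow\<close> leave out the factor for \<open>l = 0\<close>, because the first step of
  the method is accounted for by the constant \<open>C\<^sup>*\<close>.
\<close>

locale step_sizes =
  fixes \<tau> :: "nat \<Rightarrow> real"
  assumes tau0: "0 < \<tau> 0" "\<tau> 0 \<le> 1"
    and tau_root: "\<And>k. 0 < \<tau> (k + 1) \<and> \<tau> (k + 1) < 1 \<and>
      (\<tau> (k + 1)) ^ 3 + (\<tau> (k + 1))\<^sup>2 + (\<tau> k)\<^sup>2 * \<tau> (k + 1) - (\<tau> k)\<^sup>2 = 0"
begin

definition shrink :: "nat \<Rightarrow> real" where "shrink n = (\<Prod>l\<in>{1..n}. 1 - \<tau> l)"

definition grow :: "nat \<Rightarrow> real" where "grow n = (\<Prod>l\<in>{1..n}. 1 + \<tau> l)"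

lemma tau_pos: "0 < \<tau> k"
  using tau0 tau_root[of "k - 1"] by (cases k) auto

lemma tau_le_1: "\<tau> k \<le> 1"
  using tau0 tau_root[of "k - 1"] by (cases k) (auto intro: less_imp_le)

lemma tau_Suc_less_1: "\<tau> (Suc k) < 1"
  using tau_root[of k] by auto

lemma tau_ratio: "(\<tau> (Suc k))\<^sup>2 * (1 + \<tau> (Suc k)) = (\<tau> k)\<^sup>2 * (1 - \<tau> (Suc k))"
  using tau_root[of k] by (simp add: algebra_simps power2_eq_square power3_eq_cube)

lemmas tau_step = cubic_step_properties[OF tau_pos tau_Suc_less_1 tau_pos tau_le_1 tau_ratio]

lemma tau_Suc_le: "\<tau> (Suc k) \<le> \<tau> k"
proof -
  have "0 \<le> (\<tau> (Suc k))\<^sup>2" "0 \<le> (\<tau> (Suc k))^3 / 2"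
    using tau_pos[of "Suc k"] by auto
  then show ?thesis
    using tau_step(2)[of k] by linarith
qed

lemma tau_le_tau0: "\<tau> k \<le> \<tau> 0"
  by (induction k) (use tau_Suc_le order_trans in \<open>blast+\<close>)

text \<open>
  Divided by \<open>\<tau> 0\<close>, the difference of the two sides is the weight of the previous prox iterate in an
  averaged iterate.
\<close>

lemma averaging_weight_nonneg: "\<tau> (Suc k) * (1 - \<tau> 0) \<le> (1 - \<tau> (Suc k)) * \<tau> k"
proof (rule power2_le_imp_le)
  let ?x = "\<tau> (Suc k)"
  have x: "0 < ?x" "?x \<le> \<tau> 0"
    using tau_pos tau_le_tau0 by auto
  have "(1 - \<tau> 0)\<^sup>2 \<le> 1 - (\<tau> 0)\<^sup>2"
    using tau0 by (simp add: power2_eq_square algebra_simps mult_left_le)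
  also have "\<dots> \<le> 1 - ?x\<^sup>2"
    using x by (simp add: power_mono)
  finally have "?x\<^sup>2 * (1 - \<tau> 0)\<^sup>2 \<le> ?x\<^sup>2 * (1 - ?x\<^sup>2)"
    by (intro mult_left_mono) auto
  also have "\<dots> = (\<tau> k)\<^sup>2 * (1 - ?x) * (1 - ?x)"
    unfolding tau_ratio[symmetric] by (simp add: power2_eq_square algebra_simps)
  also have "\<dots> = ((1 - ?x) * \<tau> k)\<^sup>2"
    by (simp add: power2_eq_square)
  finally show "(?x * (1 - \<tau> 0))\<^sup>2 \<le> ((1 - ?x) * \<tau> k)\<^sup>2"
    by (simp add: power_mult_distrib)
  show "0 \<le> (1 - ?x) * \<tau> k"
    using tau_pos[of k] tau_Suc_less_1[of k] by auto
qed

lemma tau_ge_harmonic: "\<tau> 0 / (\<tau> 0 * real k + 1) \<le> \<tau> k"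
proof (induction k)
  case (Suc k)
  define h where "h = \<tau> 0 / (\<tau> 0 * real k + 1)"
  have h: "0 < h" "h \<le> \<tau> k"
    using Suc tau0 by (auto simp: h_def add_nonneg_pos)
  have pos: "0 < \<tau> 0 * real k + 1"
    using tau0 by (simp add: add_nonneg_pos)
  have "1 + h = (\<tau> 0 * real (Suc k) + 1) / (\<tau> 0 * real k + 1)"
    using pos by (simp add: h_def field_simps)
  then have "\<tau> 0 / (\<tau> 0 * real (Suc k) + 1) = h / (1 + h)"
    using pos by (simp add: h_def)
  also have "\<dots> \<le> \<tau> k / (1 + \<tau> k)"
    using h by (simp add: field_simps)
  also have "\<dots> \<le> \<tau> (Suc k)"
    using tau_step(1)[of k] tau_pos[of k] by (simp add: field_simps)
  finally show ?case .
qed simp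

lemma shrink_Suc: "shrink (Suc n) = shrink n * (1 - \<tau> (Suc n))"
  by (simp add: shrink_def)

lemma grow_Suc: "grow (Suc n) = grow n * (1 + \<tau> (Suc n))"
  by (simp add: grow_def)

lemma shrink_pos: "0 < shrink n"
  by (induction n) (auto simp: shrink_def tau_Suc_less_1)

lemma grow_pos: "0 < grow n"
  using tau_pos by (auto simp: grow_def intro!: prod_pos add_pos_pos)

lemma harmonic_pos: "0 < \<tau> 0 * real n + 1"
  using tau0 by (simp add: add_nonneg_pos)

lemma shrink_le: "shrink n \<le> 1 / (\<tau> 0 * real n + 1)"
proof (induction n)
  case (Suc n)
  have "1 - \<tau> (Suc n) \<le> 1 - \<tau> 0 / (\<tau> 0 * real (Suc n) + 1)"
    using tau_ge_harmonic[of "Suc n"] by simp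
  also have "\<dots> = (\<tau> 0 * real n + 1) / (\<tau> 0 * real (Suc n) + 1)"
    using harmonic_pos[of "Suc n"] by (simp add: field_simps)
  finally have "shrink (Suc n) \<le> 1 / (\<tau> 0 * real n + 1) *
      ((\<tau> 0 * real n + 1) / (\<tau> 0 * real (Suc n) + 1))"
    unfolding shrink_Suc using Suc tau_Suc_less_1[of n] harmonic_pos[of n]
    by (intro mult_mono) (auto intro: less_imp_le)
  then show ?case
    using harmonic_pos[of n] by simp
qed (simp add: shrink_def)

text \<open>The two products relative to their values for the step sizes \<open>\<tau> 0 / (\<tau> 0 * l + 1)\<close>: for
  those, \<open>grow_excess\<close> and \<open>product_defect\<close> are both 1.\<close>

definition grow_excess :: "nat \<Rightarrow> real" where
  "grow_excess n = (1 + \<tau> 0) * grow n / (\<tau> 0 * real (Suc n) + 1)"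

definition product_defect :: "nat \<Rightarrow> real" where
  "product_defect n =
     (\<tau> 0 * real n + 1) * (1 + \<tau> 0) * grow n * shrink n / (\<tau> 0 * real (Suc n) + 1)"

lemma excess_defect_0: "grow_excess 0 = 1" "product_defect 0 = 1"
  using tau0 by (auto simp: grow_excess_def product_defect_def grow_def shrink_def)

lemma excess_Suc:
  fixes n
  defines "h \<equiv> \<tau> 0 / (\<tau> 0 * real (Suc n) + 1)"
  shows "grow_excess (Suc n) = grow_excess n * ((1 + \<tau> (Suc n)) / (1 + h))"
proof -
  have "1 + h = (\<tau> 0 * real (Suc (Suc n)) + 1) / (\<tau> 0 * real (Suc n) + 1)"
    using harmonic_pos[of "Suc n"] by (simp add: h_def field_simps)
  then show ?thesis
    using harmonic_pos[of "Suc n"] harmonic_pos[of "Suc (Suc n)"]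
    unfolding grow_excess_def grow_Suc by (simp del: of_nat_Suc)
qed

lemma defect_Suc:
  fixes n
  defines "h \<equiv> \<tau> 0 / (\<tau> 0 * real (Suc n) + 1)"
  shows "product_defect (Suc n) = product_defect n * ((1 - (\<tau> (Suc n))\<^sup>2) / (1 - h\<^sup>2))"
proof -
  let ?d = "\<lambda>n. \<tau> 0 * real n + 1"
  have d: "0 < ?d n" "0 < ?d (Suc n)" "0 < ?d (Suc (Suc n))"
    using harmonic_pos[of n] harmonic_pos[of "Suc n"] harmonic_pos[of "Suc (Suc n)"] by blast+
  have "1 - h\<^sup>2 = (1 - h) * (1 + h)"
    by (simp add: power2_eq_square algebra_simps)
  also have "1 - h = ?d n / ?d (Suc n)"
    using d(2) by (simp add: h_def field_simps)
  also have "1 + h = ?d (Suc (Suc n)) / ?d (Suc n)"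
    using d(2) by (simp add: h_def field_simps)
  finally have h: "1 - h\<^sup>2 = ?d n / ?d (Suc n) * (?d (Suc (Suc n)) / ?d (Suc n))" .
  have "1 - (\<tau> (Suc n))\<^sup>2 = (1 - \<tau> (Suc n)) * (1 + \<tau> (Suc n))"
    by (simp add: power2_eq_square algebra_simps)
  then show ?thesis
    unfolding product_defect_def grow_Suc shrink_Suc h using d
    by (simp add: divide_simps del: of_nat_Suc)
qed

lemma excess_ge_1: "1 \<le> grow_excess n"
proof (induction n)
  case (Suc n)
  let ?h = "\<tau> 0 / (\<tau> 0 * real (Suc n) + 1)"
  have "0 < ?h" using tau0 harmonic_pos[of "Suc n"] by simp
  then have "1 \<le> (1 + \<tau> (Suc n)) / (1 + ?h)"
    using tau_ge_harmonic[of "Suc n"] by simp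
  then show ?case
    unfolding excess_Suc using Suc mult_mono[of 1 "grow_excess n" 1] by fastforce
qed (simp add: excess_defect_0)

lemma defect_pos: "0 < product_defect n"
  using harmonic_pos[of n] harmonic_pos[of "Suc n"] tau0 grow_pos[of n] shrink_pos[of n]
  by (auto simp: product_defect_def simp del: of_nat_Suc)

lemma harmonic_lt_1: "\<tau> 0 / (\<tau> 0 * real (Suc n) + 1) \<le> \<tau> 0 / (1 + \<tau> 0)"
  using tau0 by (intro divide_left_mono) (auto simp: algebra_simps add_pos_nonneg)

text \<open>
  Going from the harmonic step size \<open>h\<close> to \<open>x\<close> multiplies the defect by \<open>1 - u\<close> and the excess by
  \<open>1 + v\<close>, where \<open>u\<close> is smaller than \<open>v\<close> by a factor of order \<open>x + h\<close>.  So the defect falls below 1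
  by at most a multiple of order \<open>\<tau> 0\<close> of the amount by which the excess rises above 1.
\<close>

lemma defect_le_1: "product_defect n \<le> 1"
  and defect_lower: "1 - product_defect n \<le> (2 * \<tau> 0 + (\<tau> 0)\<^sup>2) * (grow_excess n - 1)"
proof (induction n)
  case (Suc n)
  define x where "x = \<tau> (Suc n)"
  define t where "t = \<tau> 0"
  define h where "h = \<tau> 0 / (\<tau> 0 * real (Suc n) + 1)"
  define K where "K = 2 * t + t\<^sup>2"
  have t: "0 < t" "t \<le> 1" using tau0 by (auto simp: t_def)
  have h: "0 < h" "h \<le> x" "h \<le> t / (1 + t)" "t / (1 + t) < 1"
    using t harmonic_pos[of "Suc n"] tau_ge_harmonic[of "Suc n"] harmonic_lt_1[of n]
    by (auto simp: h_def x_def t_def)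
  have x: "0 < x" "x \<le> t" "x < 1"
    using tau_pos tau_le_tau0 tau_Suc_less_1 by (auto simp: x_def t_def)
  have "h\<^sup>2 \<le> x\<^sup>2" "x\<^sup>2 < 1" using h x by (auto simp: power_mono abs_square_less_1)
  define u where "u = (x\<^sup>2 - h\<^sup>2) / (1 - h\<^sup>2)"
  define v where "v = (x - h) / (1 + h)"
  have "0 < 1 - h\<^sup>2" using \<open>h\<^sup>2 \<le> x\<^sup>2\<close> \<open>x\<^sup>2 < 1\<close> by linarith
  have "(1 - x\<^sup>2) / (1 - h\<^sup>2) = ((1 - h\<^sup>2) - (x\<^sup>2 - h\<^sup>2)) / (1 - h\<^sup>2)"
    by simp
  also have "\<dots> = 1 - u"
    unfolding u_def diff_divide_distrib[of "1 - h\<^sup>2"] using \<open>0 < 1 - h\<^sup>2\<close> by (subst divide_self) auto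
  finally have u1: "(1 - x\<^sup>2) / (1 - h\<^sup>2) = 1 - u" .
  have "(1 + x) / (1 + h) = ((1 + h) + (x - h)) / (1 + h)"
    by simp
  also have "\<dots> = 1 + v"
    unfolding v_def add_divide_distrib[of "1 + h"] using h by (subst divide_self) auto
  finally have v1: "(1 + x) / (1 + h) = 1 + v" .
  have "0 \<le> u" "0 \<le> v"
    unfolding u_def v_def using \<open>0 < 1 - h\<^sup>2\<close> \<open>h\<^sup>2 \<le> x\<^sup>2\<close> h by (auto intro!: divide_nonneg_pos)
  note uv = this u1 v1
  have "x + h \<le> K * (1 - h)"
  proof -
    have "x + h \<le> t + t / (1 + t)" using h x by linarith
    also have "\<dots> = K * (1 - t / (1 + t))"
      using t by (simp add: K_def field_simps power2_eq_square)
    also have "\<dots> \<le> K * (1 - h)"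
      using h t by (intro mult_left_mono) (auto simp: K_def)
    finally show ?thesis .
  qed
  then have "(x + h) * (x - h) \<le> K * (1 - h) * (x - h)"
    using h by (intro mult_right_mono) auto
  moreover have "u = (x + h) * (x - h) / ((1 - h) * (1 + h))"
    by (simp add: u_def power2_eq_square algebra_simps)
  moreover have "K * v = K * (1 - h) * (x - h) / ((1 - h) * (1 + h))"
    using h by (simp add: v_def)
  moreover have "0 < (1 - h) * (1 + h)"
    using h by auto
  ultimately have "u \<le> K * v"
    using divide_right_mono[of "(x + h) * (x - h)" "K * (1 - h) * (x - h)" "(1 - h) * (1 + h)"] by simp
  have def': "product_defect (Suc n) = product_defect n * (1 - u)"
    and exc': "grow_excess (Suc n) = grow_excess n * (1 + v)"
    using defect_Suc[of n, folded h_def x_def, unfolded uv]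
      excess_Suc[of n, folded h_def x_def, unfolded uv] by auto
  have "product_defect n * u \<le> 1 * u"
    using Suc(1) uv by (intro mult_right_mono) auto
  moreover have "K * v * 1 \<le> K * v * grow_excess n"
    using excess_ge_1[of n] uv t by (intro mult_left_mono) (auto simp: K_def)
  ultimately show "1 - product_defect (Suc n)
      \<le> (2 * \<tau> 0 + (\<tau> 0)\<^sup>2) * (grow_excess (Suc n) - 1)"
    using Suc(2) \<open>u \<le> K * v\<close> unfolding def' exc' K_def t_def by (simp add: algebra_simps)
  show "product_defect (Suc n) \<le> 1"
    unfolding def' using Suc(1) uv defect_pos[of n] by (simp add: mult_le_one algebra_simps)
      (smt (verit) mult_nonneg_nonneg)
qed (auto simp: excess_defect_0)

lemma grow_shrink_ge:
  "(5 - 2 * \<tau> 0) / (5 + 3 * \<tau> 0) \<le> grow n * shrink n * ((5 - 2 * \<tau> n) / (5 + 3 * \<tau> n))"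
proof (induction n)
  case (Suc n)
  have "(5 - 2 * \<tau> n) / (5 + 3 * \<tau> n)
      \<le> (1 - (\<tau> (Suc n))\<^sup>2) * ((5 - 2 * \<tau> (Suc n)) / (5 + 3 * \<tau> (Suc n)))"
    by (rule cubic_step_potential[OF tau_pos tau_Suc_less_1 tau_pos tau_le_1 tau_ratio])
  then have "grow n * shrink n * ((5 - 2 * \<tau> n) / (5 + 3 * \<tau> n))
      \<le> grow n * shrink n * ((1 - (\<tau> (Suc n))\<^sup>2) * ((5 - 2 * \<tau> (Suc n)) / (5 + 3 * \<tau> (Suc n))))"
    using grow_pos[of n] shrink_pos[of n] by (intro mult_left_mono) auto
  also have "\<dots> = grow (Suc n) * shrink (Suc n) * ((5 - 2 * \<tau> (Suc n)) / (5 + 3 * \<tau> (Suc n)))"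
    unfolding grow_Suc shrink_Suc by (simp add: power2_eq_square algebra_simps)
  finally show ?case using Suc by linarith
qed (simp add: grow_def shrink_def)

lemma defect_ge: "(5 - 2 * \<tau> 0) * (1 + \<tau> 0) / (5 + 3 * \<tau> 0) \<le> product_defect n"
proof -
  define h where "h = \<tau> 0 / (\<tau> 0 * real n + 1)"
  have h: "0 < h" "h \<le> \<tau> n"
    using tau0 harmonic_pos[of n] tau_ge_harmonic[of n] by (auto simp: h_def)
  have pq: "0 < grow n * shrink n"
    using grow_pos[of n] shrink_pos[of n] by simp
  have "(5 - 2 * \<tau> n) / (5 + 3 * \<tau> n) \<le> 1 / (1 + \<tau> n)"
    using tau_pos[of n] by (simp add: field_simps)
  also have "\<dots> \<le> 1 / (1 + h)"
    using h by (intro divide_left_mono) auto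
  finally have "grow n * shrink n * ((5 - 2 * \<tau> n) / (5 + 3 * \<tau> n)) \<le> grow n * shrink n * (1 / (1 + h))"
    using pq by (intro mult_left_mono) auto
  then have "(5 - 2 * \<tau> 0) / (5 + 3 * \<tau> 0) \<le> grow n * shrink n * (1 / (1 + h))"
    using grow_shrink_ge[of n] by linarith
  then have "(1 + \<tau> 0) * ((5 - 2 * \<tau> 0) / (5 + 3 * \<tau> 0)) \<le> (1 + \<tau> 0) * (grow n * shrink n * (1 / (1 + h)))"
    using tau0 by (intro mult_left_mono) auto
  moreover have "1 / (1 + h) = (\<tau> 0 * real n + 1) / (\<tau> 0 * real (Suc n) + 1)"
    using harmonic_pos[of n] harmonic_pos[of "Suc n"] h by (simp add: h_def field_simps)
  ultimately show ?thesis
    unfolding product_defect_def by (simp add: mult_ac del: of_nat_Suc)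
qed

text \<open>
  The case of a negative constant \<open>C\<^sup>* = - c\<close>, with \<open>\<kappa> = \<beta>\<^sub>0 D\<^sup>2 / 2\<close> and \<open>w = \<beta>\<^sub>0 / 2\<close> times the squared
  distance of the first dual maximizer from the centre.

  In terms of \<open>e = (1 + \<tau> 0) * c\<close>, of the excess \<open>\<eta>\<close> of \<open>grow\<close> and of the inverse \<open>\<delta>\<close> of the product
  defect, the claim is \<open>e (\<delta> \<eta> - 1) \<le> \<kappa> (\<eta> - 1) / p + t\<^sup>2 w\<close>, where \<open>p = grow n * shrink n\<close> is at most
  \<open>1 / \<delta>\<close>.  The left hand side is \<open>e \<delta> (\<eta> - 1) + e (\<delta> - 1)\<close>.  If \<open>e\<close> is smaller
  than \<open>\<kappa>\<close> by the factor \<open>1 + K\<close>, the slack in the first summand absorbs the second, as \<open>\<delta> - 1\<close> is at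
  most \<open>K \<delta> (\<eta> - 1)\<close>.  Otherwise the first summand is still dominated, \<open>\<delta> - 1\<close> is bounded by about \<open>2 t\<^sup>2 / 5\<close>, and
  the assumption that links \<open>c\<close> and \<open>w\<close> makes \<open>w\<close> comparable to \<open>e\<close>.
\<close>

lemma negative_gap_rate:
  fixes c w \<kappa> :: real and n
  assumes \<kappa>: "0 \<le> \<kappa>" and c: "0 \<le> c" "c \<le> (1 - \<tau> 0) * \<kappa>"
    and w: "0 \<le> w" "c \<le> (1 - \<tau> 0) * (\<kappa> / (2 * (1 + \<tau> 0)) + w)"
  shows "shrink n * (- c - (\<tau> 0)\<^sup>2 * w / (1 + \<tau> 0)) + \<kappa> / ((1 + \<tau> 0) * grow n)
    \<le> - c / (\<tau> 0 * real n + 1) + \<kappa> / (\<tau> 0 * real (Suc n) + 1)"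
proof -
  define t where "t = \<tau> 0"
  define e where "e = (1 + t) * c"
  define \<eta> where "\<eta> = grow_excess n"
  define \<delta> where "\<delta> = 1 / product_defect n"
  define K where "K = 2 * t + t\<^sup>2"
  define p where "p = grow n * shrink n"
  have t: "0 < t" "t \<le> 1" using tau0 by (auto simp: t_def)
  have p: "0 < p" using grow_pos[of n] shrink_pos[of n] by (simp add: p_def)
  have e0: "0 \<le> e" using c t by (simp add: e_def)
  have \<delta>1: "1 \<le> \<delta>" using defect_le_1[of n] defect_pos[of n] by (simp add: \<delta>_def)
  have \<eta>1: "1 \<le> \<eta>" using excess_ge_1 by (simp add: \<eta>_def)
  have "e \<le> (1 - t\<^sup>2) * \<kappa>"
  proof -
    have "e \<le> (1 + t) * ((1 - t) * \<kappa>)"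
      unfolding e_def t_def using c tau0 by (intro mult_left_mono) auto
    then show ?thesis by (simp add: algebra_simps power2_eq_square)
  qed
  have "\<delta> \<le> 1 / p"
  proof -
    have "\<tau> 0 * real (Suc n) + 1 \<le> (\<tau> 0 * real n + 1) * (1 + \<tau> 0)"
      using tau0 by (simp add: algebra_simps)
    then have "p \<le> product_defect n"
      unfolding product_defect_def p_def using harmonic_pos[of "Suc n"] p p_def
      by (simp add: pos_le_divide_eq mult.assoc[symmetric] del: of_nat_Suc)
         (metis mult.commute mult.left_commute mult_left_mono less_imp_le)
    then show ?thesis
      unfolding \<delta>_def using p defect_pos[of n] by (intro divide_left_mono) auto
  qed
  have key: "e * (\<delta> * \<eta> - 1) \<le> \<kappa> * \<delta> * (\<eta> - 1) + t\<^sup>2 * w"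
  proof (cases "e * (1 + K) \<le> \<kappa>")
    case True
    have "\<delta> * (1 - product_defect n) \<le> \<delta> * (K * (\<eta> - 1))"
      using defect_lower[of n] \<delta>1 by (intro mult_left_mono) (auto simp: K_def \<eta>_def t_def)
    moreover have "\<delta> * product_defect n = 1"
      using defect_pos[of n] by (simp add: \<delta>_def)
    ultimately have "\<delta> - 1 \<le> K * (\<delta> * (\<eta> - 1))"
      by (simp add: algebra_simps)
    then have "e * (\<delta> - 1) \<le> e * (K * (\<delta> * (\<eta> - 1)))"
      using e0 by (intro mult_left_mono)
    then have "e * (\<delta> * \<eta> - 1) \<le> e * (1 + K) * (\<delta> * (\<eta> - 1))"
      by (simp add: algebra_simps)
    also have "\<dots> \<le> \<kappa> * (\<delta> * (\<eta> - 1))"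
      using True \<delta>1 \<eta>1 by (intro mult_right_mono) auto
    also have "\<dots> \<le> \<kappa> * (\<delta> * (\<eta> - 1)) + t\<^sup>2 * w"
      using w by simp
    finally show ?thesis
      by (simp add: mult.assoc)
  next
    case False
    then have False': "\<kappa> < e * (1 + t)\<^sup>2"
      by (simp add: K_def power2_eq_square algebra_simps)
    have "t \<noteq> 1"
      using False \<kappa> c by (auto simp: e_def t_def)
    then have t1: "t < 1" using t by simp
    have "\<kappa> \<ge> (1 - t\<^sup>2) * \<kappa>"
      using \<kappa> by (simp add: left_diff_distrib)
    then have e\<kappa>: "e \<le> \<kappa>"
      using \<open>e \<le> (1 - t\<^sup>2) * \<kappa>\<close> by linarith
    have "\<delta> \<le> 1 / ((5 - 2 * t) * (1 + t) / (5 + 3 * t))"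
      unfolding \<delta>_def t_def using defect_ge[of n] tau0 defect_pos[of n]
      by (intro divide_left_mono) auto
    then have "\<delta> - 1 \<le> (5 + 3 * t) / ((5 - 2 * t) * (1 + t)) - 1"
      by simp
    also have "\<dots> = (5 + 3 * t - (5 - 2 * t) * (1 + t)) / ((5 - 2 * t) * (1 + t))"
      using t by (simp add: diff_divide_distrib)
    also have "5 + 3 * t - (5 - 2 * t) * (1 + t) = 2 * t\<^sup>2"
      by (simp add: algebra_simps power2_eq_square)
    finally have "e * (\<delta> - 1) \<le> e * (2 * t\<^sup>2 / ((5 - 2 * t) * (1 + t)))"
      using e0 by (intro mult_left_mono)
    also have "\<dots> \<le> t\<^sup>2 * w"
    proof -
      have "e \<le> (1 + t) * ((1 - t) * (\<kappa> / (2 * (1 + t)) + w))"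
        unfolding e_def using w t by (intro mult_left_mono) (auto simp: t_def)
      also have "\<dots> = (1 - t) * (\<kappa> / 2) + (1 - t\<^sup>2) * w"
        using t by (simp add: field_simps power2_eq_square)
      also have "(1 - t) * (\<kappa> / 2) \<le> (1 - t) * (e * (1 + t)\<^sup>2 / 2)"
        using False' t1 by (intro mult_left_mono) auto
      finally have 1: "e * ((1 - t + t\<^sup>2 + t^3) / 2) \<le> (1 - t\<^sup>2) * w"
        by (simp add: field_simps power2_eq_square power3_eq_cube)
      have "0 \<le> (1 - 3/2 * t)\<^sup>2 + 19/4 * t\<^sup>2 + 3 * t^3 - 2 * t^4"
        using t power_decreasing[of 3 4 t] zero_le_power[of t 3] zero_le_power2[of t]
          zero_le_power2[of "1 - 3/2 * t"] by linarith
      then have "4 * (1 - t) \<le> (5 - 2 * t) * (1 - t + t\<^sup>2 + t^3)"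
        by (simp add: algebra_simps power2_eq_square power3_eq_cube power4_eq_xxxx)
      then have "2 * (1 - t) / (5 - 2 * t) \<le> (1 - t + t\<^sup>2 + t^3) / 2"
        using t by (simp add: field_simps)
      then have "e * (2 * (1 - t) / (5 - 2 * t)) \<le> e * ((1 - t + t\<^sup>2 + t^3) / 2)"
        using e0 by (intro mult_left_mono)
      then have "e * (2 * (1 - t) / (5 - 2 * t)) \<le> (1 - t\<^sup>2) * w"
        using 1 by (rule order_trans)
      moreover have "e * (2 * a / D) = (a * u) * (e * (2 / (D * u)))"
        if "D \<noteq> 0" "u \<noteq> 0" for a D u :: real
        using that by simp
      from this[of "5 - 2 * t" "1 + t" "1 - t"]
      have "e * (2 * (1 - t) / (5 - 2 * t)) = (1 - t\<^sup>2) * (e * (2 / ((5 - 2 * t) * (1 + t))))"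
        using t by (simp add: power2_eq_square algebra_simps)
      moreover have "0 < 1 - t\<^sup>2" using t t1 by (simp add: power2_eq_square mult_strict_mono)
          (metis abs_of_pos abs_square_less_1 power2_eq_square)
      ultimately have "(1 - t\<^sup>2) * (e * (2 / ((5 - 2 * t) * (1 + t)))) \<le> (1 - t\<^sup>2) * w"
        "0 < 1 - t\<^sup>2"
        by (simp_all only:)
      then have "e * (2 / ((5 - 2 * t) * (1 + t))) \<le> w"
        by (rule mult_left_le_imp_le)
      then have "t\<^sup>2 * (e * (2 / ((5 - 2 * t) * (1 + t)))) \<le> t\<^sup>2 * w"
        by (intro mult_left_mono) auto
      then show ?thesis by (simp add: mult_ac)
    qed
    finally have "e * (\<delta> - 1) \<le> t\<^sup>2 * w" .
    moreover have "e * (\<delta> * (\<eta> - 1)) \<le> \<kappa> * (\<delta> * (\<eta> - 1))"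
      using e\<kappa> \<delta>1 \<eta>1 by (intro mult_right_mono) auto
    ultimately show ?thesis
      by (simp add: algebra_simps)
  qed
  have "\<kappa> * (\<delta> * (\<eta> - 1)) \<le> \<kappa> * (1 / p * (\<eta> - 1))"
    using \<kappa> \<eta>1 \<open>\<delta> \<le> 1 / p\<close> by (intro mult_left_mono mult_right_mono) auto
  then have "e * (\<delta> * \<eta> - 1) \<le> \<kappa> * (1 / p * (\<eta> - 1)) + t\<^sup>2 * w"
    using key by simp
  then have "shrink n / (1 + t) * (e * (\<delta> * \<eta> - 1)) \<le> shrink n / (1 + t) * (\<kappa> * (1 / p * (\<eta> - 1)) + t\<^sup>2 * w)"
    using shrink_pos[of n] t by (intro mult_left_mono) auto
  moreover have "shrink n / (1 + t) * (e * (\<delta> * \<eta> - 1)) = c / (\<tau> 0 * real n + 1) - c * shrink n"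
  proof -
    have "product_defect n = (\<tau> 0 * real n + 1) * shrink n * \<eta>"
      by (simp add: product_defect_def \<eta>_def grow_excess_def)
    then have "shrink n * (\<delta> * \<eta>) = 1 / (\<tau> 0 * real n + 1)"
      using shrink_pos[of n] \<eta>1 by (simp add: \<delta>_def)
    moreover have "shrink n / (1 + t) * (e * (\<delta> * \<eta> - 1)) = c * (shrink n * (\<delta> * \<eta>)) - c * shrink n"
      using t by (simp add: e_def field_simps)
    ultimately show ?thesis by simp
  qed
  moreover have "shrink n / (1 + t) * (\<kappa> * (1 / p * (\<eta> - 1)))
      = \<kappa> / (\<tau> 0 * real (Suc n) + 1) - \<kappa> / ((1 + t) * grow n)"
  proof -
    have "shrink n / (1 + t) * (\<kappa> * (1 / p * (\<eta> - 1)))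
        = (shrink n * (1 / p)) * (\<kappa> / (1 + t) * (\<eta> - 1))"
      by simp
    also have "shrink n * (1 / p) = 1 / grow n"
      using shrink_pos[of n] by (simp add: p_def)
    also have "1 / grow n * (\<kappa> / (1 + t) * (\<eta> - 1)) = \<kappa> / ((1 + t) * grow n) * (\<eta> - 1)"
      by simp
    also have "\<dots> = \<kappa> / (\<tau> 0 * real (Suc n) + 1) - \<kappa> / ((1 + t) * grow n)"
      using t grow_pos[of n] harmonic_pos[of "Suc n"]
      by (simp add: \<eta>_def grow_excess_def t_def right_diff_distrib del: of_nat_Suc)
    finally show ?thesis .
  qed
  ultimately show ?thesis
    unfolding t_def[symmetric] by (simp add: algebra_simps)
qed

end

section \<open>The iteration\<close>

text \<open>
  The iteration, with the consequences of the parameter choice in the form in which they are used.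
\<close>

locale smart_cd = composite_problem h ydot blk H f g gb A Lhat + random_indices M idx q + step_sizes \<tau>
  for h :: "real^'m::finite \<Rightarrow> real" and ydot :: "real^'m"
    and blk :: "'p::finite \<Rightarrow> 'n::finite" and H :: "'n \<Rightarrow> real^'p^'p"
    and f :: "real^'p \<Rightarrow> real" and g :: "real^'p \<Rightarrow> ereal" and gb :: "'n \<Rightarrow> real^'p \<Rightarrow> ereal"
    and A :: "real^'p^'m" and Lhat :: "'n \<Rightarrow> real"
    and M :: "'w measure" and idx :: "nat \<Rightarrow> 'w \<Rightarrow> 'n" and q :: "'n \<Rightarrow> real"
    and \<tau> :: "nat \<Rightarrow> real" +
  fixes \<beta> :: "nat \<Rightarrow> real" and B :: "nat \<Rightarrow> 'n \<Rightarrow> real" and xstar x0 :: "real^'p"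
    and xbar xtil xhat :: "nat \<Rightarrow> 'w \<Rightarrow> real^'p" and ystar :: "nat \<Rightarrow> 'w \<Rightarrow> real^'m"
  assumes Lhat_nonneg: "\<And>i. 0 \<le> Lhat i"
    and xstar_opt: "\<And>x. obj_F f g h A xstar \<le> obj_F f g h A x"
    and q_sum: "(\<Sum>i\<in>UNIV. q i) = 1" and tau0_le: "\<And>i. \<tau> 0 \<le> q i"
    and beta_pos: "\<And>k. 0 < \<beta> k" and beta_Suc: "\<And>k. \<beta> k = (1 + \<tau> k) * \<beta> (Suc k)"
    and B_def: "\<And>k i. B k i = Lhat i + (block_opnorm blk i (H i) A)\<^sup>2 / \<beta> (Suc k)"
    and B_pos: "\<And>k i. 0 < B k i"
    and init: "\<And>\<omega>. \<omega> \<in> space M \<Longrightarrow> xbar 0 \<omega> = x0" "\<And>\<omega>. \<omega> \<in> space M \<Longrightarrow> xtil 0 \<omega> = x0"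
    and xhat_step: "\<And>k \<omega>. \<omega> \<in> space M \<Longrightarrow> xhat k \<omega> = (1 - \<tau> k) *\<^sub>R xbar k \<omega> + \<tau> k *\<^sub>R xtil k \<omega>"
    and ystar_step: "\<And>k \<omega>. \<omega> \<in> space M \<Longrightarrow>
        is_arg_max (smoothing_obj h ydot (\<beta> (Suc k)) (A *v xhat k \<omega>)) (\<lambda>y. True) (ystar k \<omega>)"
    and xtil_step: "\<And>k \<omega>. \<omega> \<in> space M \<Longrightarrow>
        is_arg_min
          (block_model blk H f gb A (idx k \<omega>) (\<tau> k * B k (idx k \<omega>) / \<tau> 0)
             (xhat k \<omega>) (xtil k \<omega>) (ystar k \<omega>))
          (\<lambda>z. z \<in> block_space blk (idx k \<omega>))
          (block_part blk (idx k \<omega>) (xtil (Suc k) \<omega>))"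
    and xtil_keep: "\<And>k \<omega> i. \<omega> \<in> space M \<Longrightarrow> i \<noteq> idx k \<omega> \<Longrightarrow>
        block_part blk i (xtil (Suc k) \<omega>) = block_part blk i (xtil k \<omega>)"
    and xbar_step: "\<And>k \<omega>. \<omega> \<in> space M \<Longrightarrow>
        xbar (Suc k) \<omega> = xhat k \<omega> + (\<tau> k / \<tau> 0) *\<^sub>R (xtil (Suc k) \<omega> - xtil k \<omega>)"
begin

definition Fs :: real where "Fs = f xstar + gr xstar + h (A *v xstar)"

lemma obj_F_eq: "g x \<noteq> \<infinity> \<Longrightarrow> obj_F f g h A x = ereal (f x + gr x + h (A *v x))"
  using g_eq[OF g_finite_block, of x] by (auto simp: obj_F_def)

lemma xstar_finite: "g xstar \<noteq> \<infinity>"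
proof -
  obtain x where "g x \<noteq> \<infinity>" by (rule feasible_point)
  then have "obj_F f g h A xstar \<noteq> \<infinity>"
    using xstar_opt[of x] obj_F_eq[of x] by auto
  then show ?thesis by (auto simp: obj_F_def)
qed

lemma obj_F_xstar: "obj_F f g h A xstar = ereal Fs"
  by (simp add: obj_F_eq xstar_finite Fs_def)

lemma Fs_le: "g x \<noteq> \<infinity> \<Longrightarrow> Fs \<le> f x + gr x + h (A *v x)"
  using xstar_opt[of x] by (simp add: obj_F_xstar obj_F_eq)

text \<open>
  The initial point may be infeasible only in this case, where its gap has the coefficient
  \<open>1 - \<tau> 0 = 0\<close>.
\<close>

lemma single_block:
  assumes "\<tau> 0 = 1"
  shows "i = (j :: 'n)" and "q i = 1"
proof -
  have "of_nat (card (UNIV :: 'n set)) * \<tau> 0 \<le> (\<Sum>i\<in>UNIV. q i)"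
    by (rule sum_bounded_below) (rule tau0_le)
  then have "card (UNIV :: 'n set) \<le> Suc 0" using assms q_sum by simp
  then have *: "\<And>i j :: 'n. i = j" by (simp add: card_le_Suc0_iff_eq)
  then show "i = j" .
  have "UNIV = {i}" using * by blast
  then have "sum q {i} = 1" using q_sum by metis
  then show "q i = 1" by simp
qed

lemma prox_coeff_pos: "0 < \<tau> k * B k i / \<tau> 0"
  using tau_pos B_pos tau0 by simp

lemma state_determined: "determined k (xbar k)" "determined k (xtil k)"
proof (induction k)
  case 0
  { case 1 show ?case by (simp add: determined_def init) }
  { case 2 show ?case by (simp add: determined_def init) }
next
  case (Suc k)
  have both: "xtil (Suc k) \<omega> = xtil (Suc k) \<omega>' \<and> xbar (Suc k) \<omega> = xbar (Suc k) \<omega>'"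
    if \<omega>: "\<omega> \<in> space M" "\<omega>' \<in> space M" and agree: "agree (Suc k) \<omega> \<omega>'" for \<omega> \<omega>'
  proof -
    from agree have a: "agree k \<omega> \<omega>'" and i: "idx k \<omega> = idx k \<omega>'" by (auto simp: agree_Suc)
    have eq: "xbar k \<omega> = xbar k \<omega>'" "xtil k \<omega> = xtil k \<omega>'"
      using determinedD[OF Suc(1) \<omega> a] determinedD[OF Suc(2) \<omega> a] by auto
    then have hat: "xhat k \<omega> = xhat k \<omega>'"
      using \<omega> by (simp add: xhat_step)
    have ys: "ystar k \<omega> = ystar k \<omega>'"
      using ystar_step[OF \<omega>(2), of k] ystar_step[OF \<omega>(1), of k] unfolding hat
      by (rule argmax_unique[OF beta_pos])
    have "block_part blk (idx k \<omega>') (xtil (Suc k) \<omega>) = block_part blk (idx k \<omega>') (xtil (Suc k) \<omega>')"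
      using xtil_step[OF \<omega>(2), of k] xtil_step[OF \<omega>(1), of k] unfolding hat eq i ys
      by (rule argmin_unique[OF prox_coeff_pos])
    then have "block_part blk j (xtil (Suc k) \<omega>) = block_part blk j (xtil (Suc k) \<omega>')" for j
      using xtil_keep[OF \<omega>(1), of j k] xtil_keep[OF \<omega>(2), of j k] i eq
      by (cases "j = idx k \<omega>'") auto
    then have "xtil (Suc k) \<omega> = xtil (Suc k) \<omega>'" by (rule block_part_ext)
    then show ?thesis using \<omega> hat eq by (simp add: xbar_step)
  qed
  { case 1 show ?case using both by (simp add: determined_def) }
  { case 2 show ?case using both by (simp add: determined_def) }
qed

lemma xtil_block_new: "\<omega> \<in> space M \<Longrightarrow> P (idx k \<omega>) (xtil (Suc k) \<omega>) \<in> gdom (idx k \<omega>)"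
  by (rule argmin_in_gdom[OF prox_coeff_pos xtil_step])

lemma xtil_change:
  assumes "\<omega> \<in> space M"
  shows "xtil (Suc k) \<omega> - xtil k \<omega> = P (idx k \<omega>) (xtil (Suc k) \<omega>) - P (idx k \<omega>) (xtil k \<omega>)"
    and "gr (xtil (Suc k) \<omega>) - gr (xtil k \<omega>)
      = gbr (idx k \<omega>) (P (idx k \<omega>) (xtil (Suc k) \<omega>)) - gbr (idx k \<omega>) (P (idx k \<omega>) (xtil k \<omega>))"
proof -
  let ?i = "idx k \<omega>"
  have other: "P j (xtil (Suc k) \<omega>) = P j (xtil k \<omega>)" if "j \<noteq> ?i" for j
    using assms that by (rule xtil_keep)
  show "xtil (Suc k) \<omega> - xtil k \<omega> = P ?i (xtil (Suc k) \<omega>) - P ?i (xtil k \<omega>)"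
  proof (rule block_part_ext[of blk])
    fix j
    show "P j (xtil (Suc k) \<omega> - xtil k \<omega>) = P j (P ?i (xtil (Suc k) \<omega>) - P ?i (xtil k \<omega>))"
    proof (cases "j = ?i")
      case True
      then show ?thesis by (simp add: block_part_diff block_part_of_space)
    next
      case False
      then show ?thesis using other[OF False]
        by (simp add: block_part_diff block_part_of_other_space[OF block_part_in_space])
    qed
  qed
  have "(\<Sum>j\<in>UNIV - {?i}. gbr j (P j (xtil (Suc k) \<omega>))) = (\<Sum>j\<in>UNIV - {?i}. gbr j (P j (xtil k \<omega>)))"
    using other by (intro sum.cong) auto
  then show "gr (xtil (Suc k) \<omega>) - gr (xtil k \<omega>)
      = gbr ?i (P ?i (xtil (Suc k) \<omega>)) - gbr ?i (P ?i (xtil k \<omega>))"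
    unfolding gr_def by (simp add: sum.remove[of UNIV ?i])
qed

text \<open>
  The recursion of \<open>xbar\<close>, applied to the values of \<open>g\<close>.  For \<open>\<tau> 0 = 1\<close> the (arbitrary) value at the
  initial point cancels in the first step.
\<close>

primrec Gh :: "nat \<Rightarrow> 'w \<Rightarrow> real" where
  "Gh 0 \<omega> = gr x0"
| "Gh (Suc k) \<omega> = (1 - \<tau> k) * Gh k \<omega> + \<tau> k * gr (xtil k \<omega>)
    + \<tau> k / \<tau> 0 * (gr (xtil (Suc k) \<omega>) - gr (xtil k \<omega>))"

lemma determined_Suc: "determined k V \<Longrightarrow> determined (Suc k) V"
  by (auto simp: determined_def agree_Suc)

lemma Gh_determined: "determined k (Gh k)"
proof (induction k)
  case 0
  show ?case by (simp add: determined_def)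
next
  case (Suc k)
  show ?case
    unfolding determined_def
  proof (intro ballI impI)
    fix \<omega> \<omega>' assume \<omega>: "\<omega> \<in> space M" "\<omega>' \<in> space M" "agree (Suc k) \<omega> \<omega>'"
    show "Gh (Suc k) \<omega> = Gh (Suc k) \<omega>'"
      using determinedD[OF determined_Suc[OF Suc] \<omega>]
        determinedD[OF determined_Suc[OF state_determined(2)] \<omega>]
        determinedD[OF state_determined(2) \<omega>] by simp
  qed
qed

definition gap :: "nat \<Rightarrow> 'w \<Rightarrow> real" where
  "gap k \<omega> = f (xbar k \<omega>) + sm (\<beta> k) (A *v xbar k \<omega>) + Gh k \<omega> - Fs"

text \<open>
  The weights are those for which the expected decrease of \<open>wdist\<close> in step \<open>k\<close> is the difference
  of squared distances in \<open>one_step\<close>: the factor \<open>1 / q i\<close> compensates that block \<open>i\<close> moves only with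
  probability \<open>q i\<close>.
\<close>

definition wdist :: "nat \<Rightarrow> real^'p \<Rightarrow> real" where
  "wdist k x = (\<Sum>i\<in>UNIV. (\<tau> k)\<^sup>2 * B k i / (2 * \<tau> 0 * q i) * (bn i (P i xstar - P i x))\<^sup>2)"

definition lyap :: "nat \<Rightarrow> 'w \<Rightarrow> real" where
  "lyap k \<omega> = gap (Suc k) \<omega> + wdist k (xtil (Suc k) \<omega>)"

lemma lyap_determined: "determined (Suc k) (lyap k)"
  unfolding determined_def
proof (intro ballI impI)
  fix \<omega> \<omega>' assume \<omega>: "\<omega> \<in> space M" "\<omega>' \<in> space M" "agree (Suc k) \<omega> \<omega>'"
  show "lyap k \<omega> = lyap k \<omega>'"
    using determinedD[OF Gh_determined \<omega>] determinedD[OF state_determined(1) \<omega>]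
      determinedD[OF state_determined(2) \<omega>] by (simp add: lyap_def gap_def)
qed

lemma B_Suc_le: "B (Suc k) i \<le> (1 + \<tau> (Suc k)) * B k i"
proof -
  have "(opn i)\<^sup>2 / \<beta> (Suc (Suc k)) = (1 + \<tau> (Suc k)) * ((opn i)\<^sup>2 / \<beta> (Suc k))"
    using tau_pos[of "Suc k"] unfolding beta_Suc[of "Suc k"] by simp
  moreover have "Lhat i \<le> (1 + \<tau> (Suc k)) * Lhat i"
    using Lhat_nonneg[of i] tau_pos[of "Suc k"] by (simp add: algebra_simps)
  ultimately show ?thesis unfolding B_def by (simp add: distrib_left)
qed

lemma wdist_Suc_le: "wdist (Suc k) x \<le> (1 - \<tau> (Suc k)) * wdist k x"
  unfolding wdist_def sum_distrib_left
proof (rule sum_mono)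
  fix i
  have "(\<tau> (Suc k))\<^sup>2 * B (Suc k) i \<le> (\<tau> (Suc k))\<^sup>2 * ((1 + \<tau> (Suc k)) * B k i)"
    by (intro mult_left_mono B_Suc_le) auto
  also have "\<dots> = (1 - \<tau> (Suc k)) * ((\<tau> k)\<^sup>2 * B k i)"
    using tau_ratio[of k] by (metis mult.assoc mult.commute)
  finally have "(\<tau> (Suc k))\<^sup>2 * B (Suc k) i / (2 * \<tau> 0 * q i)
      \<le> (1 - \<tau> (Suc k)) * ((\<tau> k)\<^sup>2 * B k i) / (2 * \<tau> 0 * q i)"
    using tau0 q_pos[of i] by (intro divide_right_mono) auto
  then have "(\<tau> (Suc k))\<^sup>2 * B (Suc k) i / (2 * \<tau> 0 * q i) * (bn i (P i xstar - P i x))\<^sup>2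
      \<le> (1 - \<tau> (Suc k)) * ((\<tau> k)\<^sup>2 * B k i) / (2 * \<tau> 0 * q i) * (bn i (P i xstar - P i x))\<^sup>2"
    by (rule mult_right_mono) simp
  then show "(\<tau> (Suc k))\<^sup>2 * B (Suc k) i / (2 * \<tau> 0 * q i) * (bn i (P i xstar - P i x))\<^sup>2
      \<le> (1 - \<tau> (Suc k)) * ((\<tau> k)\<^sup>2 * B k i / (2 * \<tau> 0 * q i) * (bn i (P i xstar - P i x))\<^sup>2)"
    by simp
qed

text \<open>
  The constant \<open>C\<^sup>*(x\<^sup>0)\<close> of the theorem as a real number, which is correct if \<open>x0\<close> is feasible or
  \<open>\<tau> 0 = 1\<close>.
\<close>

definition C0 :: real where
  "C0 = (1 - \<tau> 0) * (f x0 + gr x0 + sm (\<beta> 0) (A *v x0) - Fs)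
    + (\<Sum>i\<in>UNIV. \<tau> 0 * B 0 i / (2 * q i) * (bn i (P i xstar - P i x0))\<^sup>2)"

lemma xhat_0: "\<omega> \<in> space M \<Longrightarrow> xhat 0 \<omega> = x0"
  by (simp add: xhat_step init algebra_simps flip: scaleR_add_left)

lemma beta_grow: "\<beta> (Suc k) = \<beta> 0 / ((1 + \<tau> 0) * grow k)"
proof (induction k)
  case 0
  show ?case using beta_Suc[of 0] tau0 by (simp add: grow_def)
next
  case (Suc k)
  have "\<beta> (Suc (Suc k)) = \<beta> (Suc k) / (1 + \<tau> (Suc k))"
    using beta_Suc[of "Suc k"] tau_pos[of "Suc k"] by simp
  then show ?case by (simp add: Suc grow_Suc)
qed

text \<open>If this condition fails, the bound of the theorem is infinite.\<close>

context
  assumes start: "g x0 \<noteq> \<infinity> \<or> \<tau> 0 = 1"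
begin

lemma xtil_finite:
  assumes \<omega>: "\<omega> \<in> space M" and k: "g x0 \<noteq> \<infinity> \<or> 0 < k"
  shows "P i (xtil k \<omega>) \<in> gdom i"
  using k
proof (induction k)
  case 0
  then show ?case using init(2)[OF \<omega>] by (simp add: g_finite_block)
next
  case (Suc k)
  show ?case
  proof (cases "i = idx k \<omega>")
    case True
    then show ?thesis using xtil_block_new[OF \<omega>] by simp
  next
    case False
    then have "g x0 \<noteq> \<infinity>" using start single_block(1) by blast
    then show ?thesis using Suc.IH xtil_keep[OF \<omega> False] by simp
  qed
qed

text \<open>
  All quantities of step \<open>k\<close> other than the drawn index coincide at \<open>\<omega>\<close> and at the points
  \<open>branch k \<omega> i\<close>, so \<open>one_step\<close> applies with \<open>z i\<close> read off from the \<open>i\<close>-th of these points.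
\<close>

lemma expected_lyap_step:
  assumes \<omega>: "\<omega> \<in> space M"
  shows "(\<Sum>i\<in>UNIV. q i * lyap k (branch k \<omega> i))
    \<le> (1 - \<tau> k) * gap k \<omega> + wdist k (xtil k \<omega>)
      - (\<tau> k)\<^sup>2 * \<beta> (Suc k) / 2 * (norm (ystar k \<omega> - ydot))\<^sup>2"
proof -
  define br where "br = branch k \<omega>"
  define z where "z i = P i (xtil (Suc k) (br i))" for i
  have br: "br i \<in> space M" "agree k (br i) \<omega>" "idx k (br i) = i" for i
    by (auto simp: br_def branch_space branch_agree branch_idx)
  have same: "xbar k (br i) = xbar k \<omega>" "xtil k (br i) = xtil k \<omega>" "Gh k (br i) = Gh k \<omega>" for i
    using determinedD[OF state_determined(1) br(1) \<omega> br(2)]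
      determinedD[OF state_determined(2) br(1) \<omega> br(2)]
      determinedD[OF Gh_determined br(1) \<omega> br(2)] by auto
  have hat: "xhat k (br i) = xhat k \<omega>" for i
    using same br \<omega> by (simp add: xhat_step)
  have ys: "ystar k (br i) = ystar k \<omega>" for i
    using ystar_step[OF \<omega>, of k] ystar_step[OF br(1), of k i] unfolding hat
    by (rule argmax_unique[OF beta_pos])
  have change: "xtil (Suc k) (br i) - xtil k \<omega> = z i - P i (xtil k \<omega>)"
    "gr (xtil (Suc k) (br i)) - gr (xtil k \<omega>) = gbr i (z i) - gbr i (P i (xtil k \<omega>))" for i
    using xtil_change[OF br(1), of k i] by (simp_all add: same br(3) z_def)
  let ?D = "\<lambda>j. (bn j (P j xstar - P j (xtil k \<omega>)))\<^sup>2"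
  let ?D' = "\<lambda>j. (bn j (P j xstar - z j))\<^sup>2"
  let ?w = "\<lambda>j. (\<tau> k)\<^sup>2 * B k j / (2 * \<tau> 0 * q j)"
  define E where "E i = f (xbar (Suc k) (br i)) + sm (\<beta> (Suc k)) (A *v xbar (Suc k) (br i)) + Gh (Suc k) (br i)" for i
  have "(\<Sum>i\<in>UNIV. q i * E i)
    \<le> (1 - \<tau> k) * (f (xbar k \<omega>) + sm (\<beta> k) (A *v xbar k \<omega>) + Gh k \<omega>)
      + \<tau> k * (f xstar + gr xstar + h (A *v xstar))
      + (\<Sum>i\<in>UNIV. (\<tau> k)\<^sup>2 * B k i / (2 * \<tau> 0) * (?D i - ?D' i))
      - (\<tau> k)\<^sup>2 * \<beta> (Suc k) / 2 * (norm (ystar k \<omega> - ydot))\<^sup>2"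
    unfolding E_def xbar_step[OF br(1)] Gh.simps hat same change
  proof (rule one_step)
    show "is_arg_min (block_model blk H f gb A i (\<tau> k * B k i / \<tau> 0) (xhat k \<omega>) (xtil k \<omega>) (ystar k \<omega>))
        (\<lambda>z. z \<in> block_space blk i) (z i)" for i
      using xtil_step[OF br(1), of k i] by (simp add: br(3) hat same ys z_def)
    show "P i (xtil k \<omega>) \<in> gdom i \<or> q i = \<tau> 0" for i
      using xtil_finite[OF \<omega>, of k i] start single_block(2)[of i] by auto
  qed (rule tau_pos tau_le_1 tau0(1) tau0_le q_sum beta_pos beta_Suc B_def B_pos
      xhat_step[OF \<omega>] ystar_step[OF \<omega>] xstar_finite)+
  moreover have "(\<Sum>i\<in>UNIV. q i * wdist k (xtil (Suc k) (br i)))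
    = wdist k (xtil k \<omega>) - (\<Sum>i\<in>UNIV. (\<tau> k)\<^sup>2 * B k i / (2 * \<tau> 0) * (?D i - ?D' i))"
  proof -
    have Dnew: "(bn j (P j xstar - P j (xtil (Suc k) (br i))))\<^sup>2 = ?D j - (if j = i then ?D j - ?D' j else 0)" for i j
      using xtil_keep[OF br(1), of j k i] by (auto simp: br(3) same z_def)
    have "(\<Sum>i\<in>UNIV. q i * wdist k (xtil (Suc k) (br i)))
        = (\<Sum>i\<in>UNIV. q i * (wdist k (xtil k \<omega>) - ?w i * (?D i - ?D' i)))"
    proof (rule sum.cong[OF refl])
      fix i
      have "wdist k (xtil (Suc k) (br i))
          = (\<Sum>j\<in>UNIV. ?w j * ?D j - (if j = i then ?w i * (?D i - ?D' i) else 0))"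
        unfolding wdist_def Dnew by (intro sum.cong refl) (simp add: right_diff_distrib diff_divide_distrib)
      also have "\<dots> = wdist k (xtil k \<omega>) - ?w i * (?D i - ?D' i)"
        unfolding wdist_def by (simp add: sum_subtractf)
      finally show "q i * wdist k (xtil (Suc k) (br i)) = q i * (wdist k (xtil k \<omega>) - ?w i * (?D i - ?D' i))"
        by simp
    qed
    also have "\<dots> = (\<Sum>i\<in>UNIV. q i) * wdist k (xtil k \<omega>) - (\<Sum>i\<in>UNIV. q i * (?w i * (?D i - ?D' i)))"
      unfolding right_diff_distrib[of _ "wdist k (xtil k \<omega>)"] sum_subtractf sum_distrib_right ..
    also have "(\<Sum>i\<in>UNIV. q i * (?w i * (?D i - ?D' i)))
        = (\<Sum>i\<in>UNIV. (\<tau> k)\<^sup>2 * B k i / (2 * \<tau> 0) * (?D i - ?D' i))"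
    proof (rule sum.cong[OF refl])
      fix i
      have w: "q i * ?w i = (\<tau> k)\<^sup>2 * B k i / (2 * \<tau> 0)" using q_pos[of i] by simp
      show "q i * (?w i * (?D i - ?D' i)) = (\<tau> k)\<^sup>2 * B k i / (2 * \<tau> 0) * (?D i - ?D' i)"
        unfolding w[symmetric] by (rule mult.assoc[symmetric])
    qed
    finally show ?thesis by (simp add: q_sum)
  qed
  moreover have "(\<Sum>i\<in>UNIV. q i * lyap k (br i))
      = (\<Sum>i\<in>UNIV. q i * E i) + (\<Sum>i\<in>UNIV. q i * wdist k (xtil (Suc k) (br i))) - Fs"
  proof -
    have "(\<Sum>i\<in>UNIV. q i * lyap k (br i)) = (\<Sum>i\<in>UNIV. q i * E i + q i * wdist k (xtil (Suc k) (br i)) - q i * Fs)"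
      by (intro sum.cong refl) (simp only: lyap_def gap_def E_def algebra_simps)
    also have "\<dots> = (\<Sum>i\<in>UNIV. q i * E i) + (\<Sum>i\<in>UNIV. q i * wdist k (xtil (Suc k) (br i))) - (\<Sum>i\<in>UNIV. q i) * Fs"
      by (simp only: sum.distrib sum_subtractf sum_distrib_right)
    finally show ?thesis by (simp add: q_sum)
  qed
  ultimately show ?thesis
    unfolding br_def[symmetric] gap_def Fs_def by (simp add: algebra_simps)
qed

lemma expected_lyap:
  assumes yh: "is_arg_max (smoothing_obj h ydot (\<beta> 1) (A *v x0)) (\<lambda>y. True) yh"
  shows "expectation (lyap k)
    \<le> shrink k * (C0 - (\<tau> 0)\<^sup>2 * \<beta> 1 / 2 * (norm (yh - ydot))\<^sup>2)"
proof (induction k)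
  case 0
  let ?C = "C0 - (\<tau> 0)\<^sup>2 * \<beta> 1 / 2 * (norm (yh - ydot))\<^sup>2"
  have "expectation (lyap 0) \<le> 1 * expectation (\<lambda>_. ?C)"
  proof (rule expectation_step[where k = 0])
    fix \<omega> assume \<omega>: "\<omega> \<in> space M"
    have "ystar 0 \<omega> = yh"
      using yh ystar_step[OF \<omega>, of 0] unfolding xhat_0[OF \<omega>] One_nat_def
      by (rule argmax_unique[OF beta_pos])
    moreover have "(\<tau> 0)\<^sup>2 * B 0 i / (2 * \<tau> 0 * q i) = \<tau> 0 * B 0 i / (2 * q i)" for i
      using tau0 by (simp add: power2_eq_square)
    ultimately show "(\<Sum>i\<in>UNIV. q i * lyap 0 (branch 0 \<omega> i)) \<le> 1 * ?C"
      using expected_lyap_step[OF \<omega>, of 0] init[OF \<omega>]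
      by (simp add: C0_def gap_def wdist_def algebra_simps)
  qed (rule lyap_determined | simp add: determined_def)+
  then show ?case by (simp add: shrink_def prob_space)
next
  case (Suc k)
  have "expectation (lyap (Suc k)) \<le> (1 - \<tau> (Suc k)) * expectation (lyap k)"
  proof (rule expectation_step[OF lyap_determined lyap_determined])
    fix \<omega> assume \<omega>: "\<omega> \<in> space M"
    have "0 \<le> (\<tau> (Suc k))\<^sup>2 * \<beta> (Suc (Suc k)) / 2 * (norm (ystar (Suc k) \<omega> - ydot))\<^sup>2"
      using beta_pos[of "Suc (Suc k)"] by simp
    then show "(\<Sum>i\<in>UNIV. q i * lyap (Suc k) (branch (Suc k) \<omega> i)) \<le> (1 - \<tau> (Suc k)) * lyap k \<omega>"
      using expected_lyap_step[OF \<omega>, of "Suc k"] wdist_Suc_le[of k "xtil (Suc k) \<omega>"]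
      unfolding lyap_def[of k] distrib_left by linarith
  qed
  also have "\<dots> \<le> (1 - \<tau> (Suc k)) * (shrink k * (C0 - (\<tau> 0)\<^sup>2 * \<beta> 1 / 2 * (norm (yh - ydot))\<^sup>2))"
    using Suc tau_Suc_less_1[of k] by (intro mult_left_mono) auto
  finally show ?case by (simp add: shrink_Suc mult_ac)
qed

text \<open>
  Unrolling the recursion, \<open>xbar\<close> and \<open>Gh\<close> are the same combination of the prox iterates and of
  their values.  The coefficient of the newest prox iterate is \<open>c k = \<tau> k / \<tau> 0\<close>; in the next step it
  decreases to \<open>a\<close>, and \<open>averaging_weight_nonneg\<close> says that \<open>a\<close> is not negative.  So it suffices to
  remember the newest iterate and one point \<open>w\<close> for all the older ones.
\<close>

lemma averaged_iterate_in_epigraph: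
  assumes \<omega>: "\<omega> \<in> space M"
  shows "g (xbar (Suc k) \<omega>) \<le> ereal (Gh (Suc k) \<omega>)"
proof -
  have gx: "g (xtil (Suc k) \<omega>) = ereal (gr (xtil (Suc k) \<omega>))" for k
    using xtil_finite[OF \<omega>, of "Suc k"] by (intro g_eq) auto
  define c where "c k = \<tau> k / \<tau> 0" for k
  have c: "0 < c k" "c k \<le> 1" for k
    using tau0 tau_pos[of k] tau_le_tau0[of k] by (auto simp: c_def)
  have "\<exists>w u. xbar (Suc k) \<omega> = c k *\<^sub>R xtil (Suc k) \<omega> + (1 - c k) *\<^sub>R w
      \<and> Gh (Suc k) \<omega> = c k * gr (xtil (Suc k) \<omega>) + (1 - c k) * u \<and> g w \<le> ereal u"
  proof (induction k)
    case 0
    have "c 0 = 1" using tau0 by (simp add: c_def)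
    then show ?case
      using tau0 gx[of 0]
      by (intro exI[of _ "xtil 1 \<omega>"] exI[of _ "gr (xtil 1 \<omega>)"])
         (simp add: xbar_step[OF \<omega>] xhat_0[OF \<omega>] init[OF \<omega>] algebra_simps)
  next
    case (Suc k)
    then obtain w u where wu: "xbar (Suc k) \<omega> = c k *\<^sub>R xtil (Suc k) \<omega> + (1 - c k) *\<^sub>R w"
      "Gh (Suc k) \<omega> = c k * gr (xtil (Suc k) \<omega>) + (1 - c k) * u" "g w \<le> ereal u"
      by blast
    define t where "t = \<tau> (Suc k)"
    define a where "a = (1 - t) * c k + t - c (Suc k)"
    define b where "b = (1 - t) * (1 - c k)"
    have "0 \<le> b" using c[of k] tau_Suc_less_1[of k] by (simp add: b_def t_def)
    have "a = ((1 - t) * \<tau> k - t * (1 - \<tau> 0)) / \<tau> 0"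
      using tau0 by (simp add: a_def c_def t_def field_simps)
    then have "0 \<le> a"
      using averaging_weight_nonneg[of k] tau0 by (simp add: t_def)
    have ab: "a + b = 1 - c (Suc k)"
      by (simp add: a_def b_def algebra_simps)
    from epigraph_combination[OF \<open>0 \<le> a\<close> \<open>0 \<le> b\<close> _ wu(3), of "xtil (Suc k) \<omega>" "gr (xtil (Suc k) \<omega>)"]
    obtain w' u' where wu': "a *\<^sub>R xtil (Suc k) \<omega> + b *\<^sub>R w = (1 - c (Suc k)) *\<^sub>R w'"
      "a * gr (xtil (Suc k) \<omega>) + b * u = (1 - c (Suc k)) * u'" "g w' \<le> ereal u'"
      unfolding ab using gx[of k] by auto
    have "xbar (Suc (Suc k)) \<omega> = c (Suc k) *\<^sub>R xtil (Suc (Suc k)) \<omega> + (a *\<^sub>R xtil (Suc k) \<omega> + b *\<^sub>R w)"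
      unfolding xbar_step[OF \<omega>, of "Suc k"] xhat_step[OF \<omega>] wu(1) a_def b_def c_def[of "Suc k", symmetric] t_def
      by (simp add: algebra_simps)
    moreover have "Gh (Suc (Suc k)) \<omega> = c (Suc k) * gr (xtil (Suc (Suc k)) \<omega>) + (a * gr (xtil (Suc k) \<omega>) + b * u)"
      unfolding Gh.simps(2)[of "Suc k"] wu(2) a_def b_def c_def[of "Suc k", symmetric] t_def
      by (simp add: algebra_simps)
    ultimately show ?case using wu' by metis
  qed
  then obtain w u where wu: "xbar (Suc k) \<omega> = c k *\<^sub>R xtil (Suc k) \<omega> + (1 - c k) *\<^sub>R w"
      "Gh (Suc k) \<omega> = c k * gr (xtil (Suc k) \<omega>) + (1 - c k) * u" "g w \<le> ereal u"
    by blast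
  have "g ((1 - (1 - c k)) *\<^sub>R xtil (Suc k) \<omega> + (1 - c k) *\<^sub>R w)
      \<le> ereal ((1 - (1 - c k)) * gr (xtil (Suc k) \<omega>) + (1 - c k) * u)"
    using c[of k] gx[of k] wu(3) by (intro pcc_convex_comb[OF g_pcc]) auto
  then show ?thesis unfolding wu(1,2) by simp
qed

lemma gap_bound:
  assumes \<omega>: "\<omega> \<in> space M"
  shows "obj_F f g h A (xbar (Suc k) \<omega>) - obj_F f g h A xstar
      \<le> ereal (lyap k \<omega> + \<beta> (Suc k) / 2 * R\<^sup>2)"
    and "0 \<le> lyap k \<omega> + \<beta> (Suc k) / 2 * R\<^sup>2"
proof -
  let ?x = "xbar (Suc k) \<omega>"
  have fin: "g ?x \<noteq> \<infinity>"
    using averaged_iterate_in_epigraph[OF \<omega>, of k] by auto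
  then have "gr ?x \<le> Gh (Suc k) \<omega>"
    using averaged_iterate_in_epigraph[OF \<omega>, of k] g_eq[OF g_finite_block[OF fin]] by simp
  moreover have "h (A *v ?x) \<le> sm (\<beta> (Suc k)) (A *v ?x) + \<beta> (Suc k) / 2 * R\<^sup>2"
    by (rule h_le_sm[OF less_imp_le[OF beta_pos]])
  moreover have "0 \<le> wdist k (xtil (Suc k) \<omega>)"
    unfolding wdist_def using tau0 q_pos B_pos by (intro sum_nonneg) (simp add: less_imp_le)
  ultimately have le: "f ?x + gr ?x + h (A *v ?x) - Fs \<le> lyap k \<omega> + \<beta> (Suc k) / 2 * R\<^sup>2"
    by (simp add: lyap_def gap_def)
  then show "obj_F f g h A ?x - obj_F f g h A xstar \<le> ereal (lyap k \<omega> + \<beta> (Suc k) / 2 * R\<^sup>2)"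
    by (simp add: obj_F_eq[OF fin] obj_F_xstar)
  show "0 \<le> lyap k \<omega> + \<beta> (Suc k) / 2 * R\<^sup>2"
    using le Fs_le[OF fin] by linarith
qed

lemma expected_gap_bound:
  "ereal_expectation M (\<lambda>\<omega>. obj_F f g h A (xbar (Suc k) \<omega>) - obj_F f g h A xstar)
    \<le> ereal (expectation (lyap k) + \<beta> (Suc k) / 2 * R\<^sup>2)"
proof -
  let ?X = "\<lambda>\<omega>. lyap k \<omega> + \<beta> (Suc k) / 2 * R\<^sup>2"
  have int: "integrable M (lyap k)"
    by (rule determined_expectation(1)[OF lyap_determined])
  have "(\<integral>\<^sup>+ \<omega>. e2ennreal (obj_F f g h A (xbar (Suc k) \<omega>) - obj_F f g h A xstar) \<partial>M)
      \<le> (\<integral>\<^sup>+ \<omega>. ennreal (?X \<omega>) \<partial>M)"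
    using gap_bound(1) by (intro nn_integral_mono) (metis e2ennreal_ereal e2ennreal_mono)
  also have "\<dots> = ennreal (expectation ?X)"
    using int gap_bound(2) by (intro nn_integral_eq_integral) auto
  also have "expectation ?X = expectation (lyap k) + \<beta> (Suc k) / 2 * R\<^sup>2"
    using int by (simp add: prob_space)
  finally have "ereal_expectation M (\<lambda>\<omega>. obj_F f g h A (xbar (Suc k) \<omega>) - obj_F f g h A xstar)
      \<le> enn2ereal (ennreal (expectation (lyap k) + \<beta> (Suc k) / 2 * R\<^sup>2))"
    unfolding ereal_expectation_def by (simp add: less_eq_ennreal.rep_eq)
  moreover have "0 \<le> expectation ?X"
    using gap_bound(2) by (intro integral_nonneg_AE) auto
  then have "0 \<le> expectation (lyap k) + \<beta> (Suc k) / 2 * R\<^sup>2"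
    using int by (simp add: prob_space)
  ultimately show ?thesis by (simp add: enn2ereal_ennreal)
qed

text \<open>
  For negative \<open>C0\<close>, feasibility of \<open>x0\<close> bounds \<open>- C0\<close> by \<open>1 - \<tau> 0\<close> times the loss \<open>X\<close> of smoothing at
  \<open>A x0\<close>.  The loss is at most \<open>\<kappa>\<close>, and it is small if the maximizer \<open>yh\<close> is close to \<open>ydot\<close>.
\<close>

lemma rate_bound:
  assumes yh: "is_arg_max (smoothing_obj h ydot (\<beta> 1) (A *v x0)) (\<lambda>y. True) yh"
  shows "shrink k * (C0 - (\<tau> 0)\<^sup>2 * \<beta> 1 / 2 * (norm (yh - ydot))\<^sup>2) + \<beta> (Suc k) / 2 * R\<^sup>2
    \<le> C0 / (\<tau> 0 * real k + 1) + \<beta> 0 * R\<^sup>2 / (2 * (\<tau> 0 * real (Suc k) + 1))"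
proof -
  define t where "t = \<tau> 0"
  define N where "N = norm (yh - ydot)"
  define \<kappa> where "\<kappa> = \<beta> 0 * R\<^sup>2 / 2"
  define w where "w = \<beta> 0 * N\<^sup>2 / 2"
  have t: "0 < t" "t \<le> 1" using tau0 by (auto simp: t_def)
  have b0: "\<beta> 0 = (1 + t) * \<beta> 1" using beta_Suc[of 0] by (simp add: t_def)
  have b: "0 < \<beta> 1" "0 < \<beta> 0" by (rule beta_pos)+
  have slack: "(\<tau> 0)\<^sup>2 * \<beta> 1 / 2 * N\<^sup>2 = t\<^sup>2 * w / (1 + t)"
  proof -
    have "w = (1 + t) * (\<beta> 1 / 2 * N\<^sup>2)"
      unfolding w_def b0 by simp
    then have "w / (1 + t) = \<beta> 1 / 2 * N\<^sup>2"
      using t by (simp only: nonzero_mult_div_cancel_left)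
    then have "t\<^sup>2 * (w / (1 + t)) = t\<^sup>2 * (\<beta> 1 / 2 * N\<^sup>2)" by (rule arg_cong)
    then show ?thesis by (simp add: t_def)
  qed
  have last: "\<beta> (Suc k) / 2 * R\<^sup>2 = \<kappa> / ((1 + t) * grow k)"
    by (simp add: beta_grow \<kappa>_def t_def)
  have last': "\<beta> 0 * R\<^sup>2 / (2 * (\<tau> 0 * real (Suc k) + 1)) = \<kappa> / (t * real (Suc k) + 1)"
    by (simp add: \<kappa>_def t_def del: of_nat_Suc)
  have \<kappa>: "0 \<le> \<kappa>" and w: "0 \<le> w" using b by (auto simp: \<kappa>_def w_def)
  have "shrink k * (C0 - t\<^sup>2 * w / (1 + t)) + \<kappa> / ((1 + t) * grow k)
      \<le> C0 / (t * real k + 1) + \<kappa> / (t * real (Suc k) + 1)"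
  proof (cases "0 \<le> C0")
    case True
    have "shrink k * (C0 - t\<^sup>2 * w / (1 + t)) \<le> shrink k * C0"
      using t w shrink_pos[of k] by (intro mult_left_mono) auto
    also have "\<dots> \<le> 1 / (t * real k + 1) * C0"
      using shrink_le[of k] True by (intro mult_right_mono) (auto simp: t_def)
    finally have 1: "shrink k * (C0 - t\<^sup>2 * w / (1 + t)) \<le> C0 / (t * real k + 1)" by simp
    (* This is 1 \<le> grow_excess k. *)
    have "t * real (Suc k) + 1 \<le> (1 + t) * grow k"
      using excess_ge_1[of k] harmonic_pos[of "Suc k"]
      by (simp add: grow_excess_def t_def del: of_nat_Suc)
    then have "\<kappa> / ((1 + t) * grow k) \<le> \<kappa> / (t * real (Suc k) + 1)"
      using \<kappa> t harmonic_pos[of "Suc k"] grow_pos[of k]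
      by (intro divide_left_mono) (auto simp: t_def simp del: of_nat_Suc)
    with 1 show ?thesis by linarith
  next
    case False
    define X where "X = h (A *v x0) - sm (\<beta> 0) (A *v x0)"
    have dist: "0 \<le> (\<Sum>i\<in>UNIV. \<tau> 0 * B 0 i / (2 * q i) * (bn i (P i xstar - P i x0))\<^sup>2)"
      using tau0 q_pos B_pos by (intro sum_nonneg) (simp add: less_imp_le)
    have "t \<noteq> 1" using False dist by (auto simp: C0_def t_def)
    then have "g x0 \<noteq> \<infinity>" using start by (simp add: t_def)
    have "(1 - t) * (- X) \<le> (1 - t) * (f x0 + gr x0 + sm (\<beta> 0) (A *v x0) - Fs)"
      using Fs_le[OF \<open>g x0 \<noteq> \<infinity>\<close>] t by (intro mult_left_mono) (auto simp: X_def)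
    then have cX: "- C0 \<le> (1 - t) * X"
      using dist by (simp add: C0_def t_def)
    have "X \<le> \<kappa>"
      using h_le_sm[of "\<beta> 0" "A *v x0"] b by (simp add: X_def \<kappa>_def)
    have "X \<le> \<kappa> / (2 * (1 + t)) + w"
    proof -
      have "X \<le> \<beta> 1 / 2 * (2 * R * N - N\<^sup>2) + t * \<beta> 1 / 2 * N\<^sup>2"
        using h_le_sm_argmax[OF b(1) yh] sm_linearization_le_sm[OF b(1) yh, of "\<beta> 0" "A *v x0"] b
        by (simp add: X_def N_def b0 algebra_simps)
      also have "\<dots> \<le> \<beta> 1 / 2 * (R\<^sup>2 / 2 + 2 * N\<^sup>2 - N\<^sup>2) + t * \<beta> 1 / 2 * N\<^sup>2"
      proof -
        (* This split of 2 R N gives R a small share, so that the coefficient of \<kappa> is below 1. *)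
        have "0 \<le> (R - 2 * N)\<^sup>2" by simp
        then have "2 * R * N \<le> R\<^sup>2 / 2 + 2 * N\<^sup>2" by (simp add: power2_diff field_simps)
        then show ?thesis using b by (intro add_mono mult_left_mono order_refl) auto
      qed
      also have "\<dots> = \<kappa> / (2 * (1 + t)) + w"
        using t by (simp add: \<kappa>_def w_def b0 field_simps)
      finally show ?thesis .
    qed
    have "(1 - t) * X \<le> (1 - t) * \<kappa>" "(1 - t) * X \<le> (1 - t) * (\<kappa> / (2 * (1 + t)) + w)"
      using \<open>X \<le> \<kappa>\<close> \<open>X \<le> \<kappa> / (2 * (1 + t)) + w\<close> t by (auto intro!: mult_left_mono)
    then show ?thesis
      using negative_gap_rate[of \<kappa> "- C0" w k] cX \<kappa> w False
      unfolding t_def[symmetric] by simp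
  qed
  then show ?thesis
    unfolding slack[unfolded N_def] last last' unfolding t_def[symmetric] .
qed

lemma expected_gap_rate:
  "ereal_expectation M (\<lambda>\<omega>. obj_F f g h A (xbar (Suc k) \<omega>) - obj_F f g h A xstar)
    \<le> ereal (C0 / (\<tau> 0 * real k + 1) + \<beta> 0 * R\<^sup>2 / (2 * (\<tau> 0 * real (Suc k) + 1)))"
proof -
  obtain \<omega> where \<omega>: "\<omega> \<in> space M" using not_empty by blast
  have yh: "is_arg_max (smoothing_obj h ydot (\<beta> 1) (A *v x0)) (\<lambda>y. True) (ystar 0 \<omega>)"
    using ystar_step[OF \<omega>, of 0] xhat_0[OF \<omega>] by simp
  show ?thesis
    using expected_gap_bound[of k] expected_lyap[OF yh, of k] rate_bound[OF yh, of k]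
    by (elim order_trans) simp
qed

end

end

section \<open>The convergence rate\<close>

theorem theorem3p3:
  fixes blk :: "'p::finite \<Rightarrow> 'n::finite"
    and H :: "'n \<Rightarrow> real^'p^'p"
    and f :: "real^'p \<Rightarrow> real"
    and g :: "real^'p \<Rightarrow> ereal"
    and gb :: "'n \<Rightarrow> real^'p \<Rightarrow> ereal"
    and h :: "real^'m::finite \<Rightarrow> real"
    and A :: "real^'p^'m"
    and Lhat :: "'n \<Rightarrow> real"
    and ydot :: "real^'m"
    and xstar x0 :: "real^'p"
    and \<alpha> :: real
    and \<tau> \<beta> :: "nat \<Rightarrow> real"
    and B :: "nat \<Rightarrow> 'n \<Rightarrow> real"
    and q :: "'n \<Rightarrow> real"
    and M :: "'w measure"
    and idx :: "nat \<Rightarrow> 'w \<Rightarrow> 'n"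
    and xbar xtil xhat :: "nat \<Rightarrow> 'w \<Rightarrow> real^'p"
    and ystar :: "nat \<Rightarrow> 'w \<Rightarrow> real^'m"
  assumes blocks: "surj blk"
    and H_spd: "\<forall>i. block_spd blk i (H i)"
    \<comment> \<open>the problem\<close>
    and f_pcc: "proper_closed_convex (\<lambda>x. ereal (f x))"
    and g_pcc: "proper_closed_convex g"
    and h_pcc: "proper_closed_convex (\<lambda>u. ereal (h u))"
    and f_diff: "\<forall>x. f differentiable (at x)"
    and Lhat_nonneg: "\<forall>i. 0 \<le> Lhat i"
    and f_block_smooth:
      "\<forall>i x. \<forall>d\<in>block_space blk i.
         block_dual_norm blk i (H i)
           (block_part blk i (gradient f (x + d)) - block_part blk i (gradient f x))
         \<le> Lhat i * block_norm (H i) d"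
    and g_separable: "\<forall>x. g x = (\<Sum>i\<in>UNIV. gb i (block_part blk i x))"
    and gb_values: "\<forall>i. \<forall>z\<in>block_space blk i. gb i z \<noteq> -\<infinity>"
    and h_lipschitz: "\<exists>K. K-lipschitz_on UNIV h"
    and xstar_opt: "\<forall>x. obj_F f g h A xstar \<le> obj_F f g h A x"
    \<comment> \<open>parameters of the algorithm\<close>
    and beta1_pos: "0 < \<beta> 1"
    and alpha: "0 \<le> \<alpha>" "\<alpha> \<le> 1"
    and B_def: "\<forall>k i. B k i = Lhat i + (block_opnorm blk i (H i) A)\<^sup>2 / \<beta> (k + 1)"
    and B0_pos: "\<forall>i. 0 < B 0 i"
    and q_def: "\<forall>i. q i = B 0 i powr \<alpha> / (\<Sum>j\<in>UNIV. B 0 j powr \<alpha>)"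
    and tau0: "\<tau> 0 = Min (range q)"
    and tau_step: "\<forall>k. 0 < \<tau> (k + 1) \<and> \<tau> (k + 1) < 1 \<and>
        (\<tau> (k + 1)) ^ 3 + (\<tau> (k + 1))\<^sup>2 + (\<tau> k)\<^sup>2 * \<tau> (k + 1) - (\<tau> k)\<^sup>2 = 0"
    and beta0: "\<beta> 0 = (1 + \<tau> 0) * \<beta> 1"
    and beta_step: "\<forall>k. \<beta> (k + 2) = \<beta> (k + 1) / (1 + \<tau> (k + 1))"
    \<comment> \<open>the random indices\<close>
    and M_prob: "prob_space M"
    and idx_indep: "prob_space.indep_vars M (\<lambda>_. count_space UNIV) idx UNIV"
    and idx_distr: "\<forall>k i. measure M {\<omega>\<in>space M. idx k \<omega> = i} = q i"
    \<comment> \<open>the iteration\<close>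
    and init: "\<forall>\<omega>\<in>space M. xbar 0 \<omega> = x0 \<and> xtil 0 \<omega> = x0"
    and xhat_step: "\<forall>k. \<forall>\<omega>\<in>space M.
        xhat k \<omega> = (1 - \<tau> k) *\<^sub>R xbar k \<omega> + \<tau> k *\<^sub>R xtil k \<omega>"
    and ystar_step: "\<forall>k. \<forall>\<omega>\<in>space M.
        is_arg_max (smoothing_obj h ydot (\<beta> (k + 1)) (A *v xhat k \<omega>)) (\<lambda>y. True) (ystar k \<omega>)"
    and xtil_step: "\<forall>k. \<forall>\<omega>\<in>space M.
        is_arg_min
          (block_model blk H f gb A (idx k \<omega>) (\<tau> k * B k (idx k \<omega>) / \<tau> 0)
             (xhat k \<omega>) (xtil k \<omega>) (ystar k \<omega>))
          (\<lambda>z. z \<in> block_space blk (idx k \<omega>))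
          (block_part blk (idx k \<omega>) (xtil (k + 1) \<omega>))"
    and xtil_keep: "\<forall>k. \<forall>\<omega>\<in>space M. \<forall>i. i \<noteq> idx k \<omega> \<longrightarrow>
        block_part blk i (xtil (k + 1) \<omega>) = block_part blk i (xtil k \<omega>)"
    and xbar_step: "\<forall>k. \<forall>\<omega>\<in>space M.
        xbar (k + 1) \<omega> = xhat k \<omega> + (\<tau> k / \<tau> 0) *\<^sub>R (xtil (k + 1) \<omega> - xtil k \<omega>)"
  shows "dual_radius h ydot < \<infinity> \<and>
    (\<forall>k\<ge>1.
      ereal_expectation M (\<lambda>\<omega>. obj_F f g h A (xbar k \<omega>) - obj_F f g h A xstar)
      \<le> (ereal (1 - \<tau> 0) * (obj_F_smoothed f g h A ydot (\<beta> 0) x0 - obj_F f g h A xstar)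
          + ereal (\<Sum>i\<in>UNIV. \<tau> 0 * B 0 i / (2 * q i) *
                     (block_norm (H i) (block_part blk i xstar - block_part blk i x0))\<^sup>2))
          / ereal (\<tau> 0 * (real k - 1) + 1)
        + ereal (\<beta> 1 * (1 + \<tau> 0)) * (dual_radius h ydot)\<^sup>2 / ereal (2 * (\<tau> 0 * real k + 1)))"
proof -
  define S where "S = (\<Sum>j\<in>UNIV. B 0 j powr \<alpha>)"
  have weight_pos: "0 < B 0 i powr \<alpha>" for i
    using B0_pos[rule_format, of i] by simp
  then have "0 < S"
    unfolding S_def by (intro sum_pos) auto
  have q: "q i = B 0 i powr \<alpha> / S" for i
    using q_def by (simp add: S_def)
  have q_pos: "0 < q i" for i
    using weight_pos \<open>0 < S\<close> unfolding q by (rule divide_pos_pos)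
  have q_sum: "(\<Sum>i\<in>UNIV. q i) = 1"
    using \<open>0 < S\<close> by (simp add: q S_def flip: sum_divide_distrib)
  have tau0_le: "\<tau> 0 \<le> q i" for i
    unfolding tau0 by (rule Min_le) auto
  have "\<tau> 0 \<in> range q"
    unfolding tau0 by (rule Min_in) auto
  then have tau0_pos: "0 < \<tau> 0" using q_pos by auto
  have "q i \<le> (\<Sum>i\<in>UNIV. q i)" for i
    using q_pos by (intro member_le_sum) (auto intro: less_imp_le)
  then have tau0_le_1: "\<tau> 0 \<le> 1"
    using tau0_le q_sum order_trans by metis
  interpret step_sizes \<tau>
    using tau0_pos tau0_le_1 tau_step by unfold_locales auto
  have beta_pos_Suc: "0 < \<beta> (Suc k) \<and> \<beta> (Suc k) \<le> \<beta> 1" for k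
  proof (induction k)
    case (Suc k)
    have "\<beta> (Suc (Suc k)) = \<beta> (Suc k) / (1 + \<tau> (Suc k))"
      using beta_step[rule_format, of k] by simp
    moreover have "\<beta> (Suc k) / (1 + \<tau> (Suc k)) \<le> \<beta> (Suc k) / 1"
      using Suc tau_pos[of "Suc k"] by (intro divide_left_mono) auto
    ultimately show ?case
      using Suc tau_pos[of "Suc k"] by (auto intro!: divide_pos_pos)
  qed (use beta1_pos in simp)
  have beta_pos: "0 < \<beta> k" for k
    using beta_pos_Suc[of "k - 1"] beta0 beta1_pos tau0_pos by (cases k) auto
  have beta_Suc: "\<beta> k = (1 + \<tau> k) * \<beta> (Suc k)" for k
  proof (cases k)
    case (Suc l)
    then show ?thesis
      using beta_step[rule_format, of l] tau_pos[of k] by (simp add: add_pos_pos)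
  qed (use beta0 in simp)
  have B_eq: "B k i = Lhat i + (block_opnorm blk i (H i) A)\<^sup>2 / \<beta> (Suc k)" for k i
    using B_def by simp
  have B_pos: "0 < B k i" for k i
  proof -
    have "(block_opnorm blk i (H i) A)\<^sup>2 / \<beta> (Suc 0) \<le> (block_opnorm blk i (H i) A)\<^sup>2 / \<beta> (Suc k)"
      using beta_pos_Suc[of k] by (intro divide_left_mono) auto
    then show ?thesis
      using B0_pos[rule_format, of i] unfolding B_eq[of 0] B_eq[of k] by linarith
  qed
  note rules = h_pcc h_lipschitz H_spd[rule_format] f_pcc g_pcc f_diff[rule_format]
    f_block_smooth[rule_format] g_separable[rule_format] gb_values[rule_format]
    idx_indep idx_distr[rule_format] q_pos Lhat_nonneg[rule_format] xstar_opt[rule_format]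
    q_sum tau0_le beta_pos beta_Suc B_eq B_pos init[rule_format, THEN conjunct1]
    init[rule_format, THEN conjunct2] xhat_step[rule_format]
    ystar_step[rule_format, unfolded Suc_eq_plus1[symmetric]]
    xtil_step[rule_format, unfolded Suc_eq_plus1[symmetric]]
    xtil_keep[rule_format, unfolded Suc_eq_plus1[symmetric]]
    xbar_step[rule_format, unfolded Suc_eq_plus1[symmetric]]
  interpret prob_space M by (rule M_prob)
  interpret smart_cd h ydot blk H f g gb A Lhat M idx q \<tau> \<beta> B xstar x0 xbar xtil xhat ystar
    by unfold_locales (fact rules)+
  show ?thesis
  proof (intro conjI allI impI)
    show "dual_radius h ydot < \<infinity>" by (simp add: dual_radius_eq)
    fix k :: nat assume "1 \<le> k"
    then obtain n where k: "k = Suc n" by (cases k) auto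
    have n: "real k - 1 = real n" by (simp add: k)
    let ?dist = "\<Sum>i\<in>UNIV. \<tau> 0 * B 0 i / (2 * q i) *
      (block_norm (H i) (block_part blk i xstar - block_part blk i x0))\<^sup>2"
    let ?T = "ereal (\<beta> 1 * (1 + \<tau> 0)) * (dual_radius h ydot)\<^sup>2 / ereal (2 * (\<tau> 0 * real k + 1))"
    have pos: "0 < \<tau> 0 * real n + 1" "0 < \<tau> 0 * real k + 1"
      using harmonic_pos[of n] harmonic_pos[of k] by auto
    have T: "?T = ereal (\<beta> 0 * R\<^sup>2 / (2 * (\<tau> 0 * real k + 1)))"
      using pos by (simp add: dual_radius_eq beta0 power2_eq_square mult.commute)
    show "ereal_expectation M (\<lambda>\<omega>. obj_F f g h A (xbar k \<omega>) - obj_F f g h A xstar)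
      \<le> (ereal (1 - \<tau> 0) * (obj_F_smoothed f g h A ydot (\<beta> 0) x0 - obj_F f g h A xstar)
          + ereal ?dist) / ereal (\<tau> 0 * (real k - 1) + 1) + ?T"
    proof (cases "g x0 \<noteq> \<infinity> \<or> \<tau> 0 = 1")
      case True
      have gap0: "ereal (1 - \<tau> 0) * (obj_F_smoothed f g h A ydot (\<beta> 0) x0 - obj_F f g h A xstar)
          = ereal ((1 - \<tau> 0) * (f x0 + gr x0 + sm (\<beta> 0) (A *v x0) - Fs))"
      proof (cases "\<tau> 0 = 1")
        case False
        then have "g x0 = ereal (gr x0)" using True by (intro g_eq g_finite_block) auto
        then show ?thesis
          using beta_pos[of 0] by (simp add: obj_F_smoothed_def smoothed_eq obj_F_xstar)
      qed (simp flip: zero_ereal_def)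
      show ?thesis
        unfolding T n gap0 using expected_gap_rate[OF True, of n, folded k] pos by (simp add: C0_def)
    next
      case False
      then have "obj_F_smoothed f g h A ydot (\<beta> 0) x0 = \<infinity>"
        using beta_pos[of 0] by (simp add: obj_F_smoothed_def smoothed_eq)
      moreover have "0 < 1 - \<tau> 0" using False tau0_le_1 by simp
      ultimately show ?thesis
        unfolding T n using pos by (simp add: obj_F_xstar)
    qed
  qed
qed

end
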